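(* Let $\Omega\subset\mathbb{R}^N$ ($N\ge2$) be a domain, let $p:\Omega\to(1,\infty)$ be a $C^1$ function, and let $u:\Omega\to\mathbb{R}$ be continuous. Define $\alpha_p(x),\beta_p(x)$ by $\alpha_p(x)+\beta_p(x)=1$ and $\frac{\alpha_p(x)}{\beta_p(x)}=\frac{p(x)-2}{N+2}$. Then $u$ is a viscosity solution (in the sense given in the context) of $$-\operatorname{div}\left(|\nabla u|^{p(x)-2}\nabla u\right)=0\quad\text{in }\Omega$$ if and only if the asymptotic expansion $$\begin{aligned}u(x)={}&\frac{\alpha_p(x)}{2}\left\{\max_{\overline{B_\varepsilon(x)}}u+\min_{\overline{B_\varepsilon(x)}}u\right\}+\beta_p(x)\,\frac{1}{|B_\varepsilon(x)|}\int_{B_\varepsilon(x)}u(y)\,dy\\&+\frac{\varepsilon\ln|\nabla u(x)|}{4(N+p(x))}\,\frac{1}{|B_\varepsilon(x)|}\int_{B_\varepsilon(x)}\big(u(y+\varepsilon\nabla p(x))-u(y-\varepsilon\nabla p(x))\big)\,dy+o(\varepsilon^2)\end{aligned}$$ as $\varepsilon\to0$ holds for all $x\in\Omega$ in the viscosity sense (as defined in the context).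
   Context: $B_\varepsilon(x)$ is the open ball of radius $\varepsilon$ centred at $x$, and $|B_\varepsilon(x)|$ its Lebesgue measure. When $\nabla\phi(x)\ne0$, $\Delta_\infty\phi(x)=|\nabla\phi(x)|^{-2}\langle D^2\phi(x)\nabla\phi(x),\nabla\phi(x)\rangle$. **Viscosity solution.** The continuous function $u$ is a viscosity solution if for every $x\in\Omega$: for every $C^2$ function $\phi$ such that $u-\phi$ has a strict minimum at $x$ and $\nabla\phi(x)\ne0$, $$-(p(x)-2)\Delta_\infty\phi(x)-\Delta\phi(x)-\ln|\nabla\phi(x)|\,\langle\nabla p(x),\nabla\phi(x)\rangle\ge0,$$ and for every $C^2$ function $\phi$ such that $u-\phi$ has a strict maximum at $x$ and $\nabla\phi(x)\neq0$, the same expression is $\le0$. **Asymptotic expansion in the viscosity sense.** For a $C^2$ function $\phi$ with $\nabla\phi(x)\neq0$, let $E_\varepsilon[\phi](x)$ be $-\phi(x)$ plus the right-hand side of the expansion (without $o(\varepsilon^2)$) with $u$ replaced by $\phi$ everywhere. The expansion holds at $x$ in the viscosity sense if: (i) for every $C^2$ function $\phi$ such that $u-\phi$ has a strict minimum at $x$ with $u(x)=\phi(x)$ and $\nabla\phi(x)\ne0$, $0\ge E_\varepsilon[\phi](x)+o(\varepsilon^2)$ as $\varepsilon\to0$; (ii) for every $C^2$ function $\phi$ such that $u-\phi$ has a strict maximum at $x$ with $u(x)=\phi(x)$ and $\nabla\phi(x)\ne0$, $0\le E_\varepsilon[\phi](x)+o(\varepsilon^2)$ as $\varepsilon\to0$.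 Here $0\ge E_\varepsilon+o(\varepsilon^2)$ means that there is $r(\varepsilon)$ with $r(\varepsilon)/\varepsilon^2\to0$ as $\varepsilon\to0^+$ and $E_\varepsilon+r(\varepsilon)\le0$ for all sufficiently small $\varepsilon>0$; similarly for $\le$. *)

theory Defs
  imports "HOL-Analysis.Analysis"
begin

definition grad :: "(real^'n \<Rightarrow> real) \<Rightarrow> real^'n \<Rightarrow> real^'n" where
  "grad f x = (THE D. GDERIV f x :> D)"

lemma grad_eq: "grad f x = D" if "GDERIV f x :> D"
  unfolding grad_def
proof (rule the_equality)
  show "GDERIV f x :> D" by (fact that)
next
  fix D' assume "GDERIV f x :> D'"
  then have "(\<lambda>h. h \<bullet> D') = (\<lambda>h. h \<bullet> D)"
    using that has_derivative_unique unfolding gderiv_def by blast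
  then show "D' = D"
    by (metis inner_commute vector_eq_ldot)
qed

definition hess :: "(real^'n \<Rightarrow> real) \<Rightarrow> real^'n \<Rightarrow> real^'n^'n" where
  "hess f x = jacobian (grad f) (at x)"

definition laplacian :: "(real^'n \<Rightarrow> real) \<Rightarrow> real^'n \<Rightarrow> real" where
  "laplacian f x = trace (hess f x)"

text \<open>The normalised infinity Laplacian; used only where the gradient does not vanish.\<close>

definition inf_laplacian :: "(real^'n \<Rightarrow> real) \<Rightarrow> real^'n \<Rightarrow> real" where
  "inf_laplacian f x = ((hess f x *v grad f x) \<bullet> grad f x) / (norm (grad f x))\<^sup>2"

text \<open>\<open>C1_on\<close> and \<open>C2_on\<close> are meant for open sets. Functions on an open set \<open>S\<close> are represented by
  total functions whose values outside \<open>S\<close> are irrelevant.\<close>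

definition C1_on :: "(real^'n) set \<Rightarrow> (real^'n \<Rightarrow> real) \<Rightarrow> bool" where
  "C1_on S f \<longleftrightarrow> (\<forall>x\<in>S. f differentiable (at x)) \<and> continuous_on S (grad f)"

definition C2_on :: "(real^'n) set \<Rightarrow> (real^'n \<Rightarrow> real) \<Rightarrow> bool" where
  "C2_on S f \<longleftrightarrow> C1_on S f \<and> (\<forall>x\<in>S. grad f differentiable (at x)) \<and> continuous_on S (hess f)"

definition strict_min_at :: "'a set \<Rightarrow> ('a \<Rightarrow> real) \<Rightarrow> 'a \<Rightarrow> bool" where
  "strict_min_at S f x \<longleftrightarrow> x \<in> S \<and> (\<forall>y\<in>S. y \<noteq> x \<longrightarrow> f x < f y)"

definition strict_max_at :: "'a set \<Rightarrow> ('a \<Rightarrow> real) \<Rightarrow> 'a \<Rightarrow> bool" where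
  "strict_max_at S f x \<longleftrightarrow> x \<in> S \<and> (\<forall>y\<in>S. y \<noteq> x \<longrightarrow> f y < f x)"

text \<open>\<open>neg_px_laplace p \<phi> x\<close> is \<open>-div(|\<nabla>\<phi>|^(p(x)-2) \<nabla>\<phi>)\<close> expanded and divided by the positive
  factor \<open>|\<nabla>\<phi>|^(p(x)-2)\<close>.\<close>

definition neg_px_laplace :: "(real^'n \<Rightarrow> real) \<Rightarrow> (real^'n \<Rightarrow> real) \<Rightarrow> real^'n \<Rightarrow> real" where
  "neg_px_laplace p \<phi> x =
     - (p x - 2) * inf_laplacian \<phi> x - laplacian \<phi> x
     - ln (norm (grad \<phi> x)) * (grad p x \<bullet> grad \<phi> x)"

definition viscosity_solution ::
    "(real^'n) set \<Rightarrow> (real^'n \<Rightarrow> real) \<Rightarrow> (real^'n \<Rightarrow> real) \<Rightarrow> bool" where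
  "viscosity_solution \<Omega> p u \<longleftrightarrow>
     (\<forall>x\<in>\<Omega>.
        (\<forall>\<phi>. C2_on \<Omega> \<phi> \<and> strict_min_at \<Omega> (\<lambda>y. u y - \<phi> y) x \<and> grad \<phi> x \<noteq> 0
              \<longrightarrow> neg_px_laplace p \<phi> x \<ge> 0) \<and>
        (\<forall>\<phi>. C2_on \<Omega> \<phi> \<and> strict_max_at \<Omega> (\<lambda>y. u y - \<phi> y) x \<and> grad \<phi> x \<noteq> 0
              \<longrightarrow> neg_px_laplace p \<phi> x \<le> 0))"

definition ball_average :: "real^'n \<Rightarrow> real \<Rightarrow> (real^'n \<Rightarrow> real) \<Rightarrow> real" where
  "ball_average x \<epsilon> f = (LINT y:ball x \<epsilon>|lebesgue. f y) / measure lebesgue (ball x \<epsilon>)"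

text \<open>Only the behaviour as \<open>\<epsilon>\<close> tends to 0 matters. For small \<open>\<epsilon>\<close> the closed ball and the two shifted
  balls lie in the open set on which \<open>\<phi>\<close> is continuous, so the supremum and infimum are
  attained and the integrals exist.\<close>

definition expansion_E ::
    "(real^'n \<Rightarrow> real) \<Rightarrow> (real^'n \<Rightarrow> real) \<Rightarrow> (real^'n \<Rightarrow> real) \<Rightarrow> (real^'n \<Rightarrow> real)
      \<Rightarrow> real^'n \<Rightarrow> real \<Rightarrow> real" where
  "expansion_E p \<alpha> \<beta> \<phi> x \<epsilon> =
     - \<phi> x
     + \<alpha> x / 2 * ((SUP y\<in>cball x \<epsilon>. \<phi> y) + (INF y\<in>cball x \<epsilon>. \<phi> y))
     + \<beta> x * ball_average x \<epsilon> \<phi>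
     + \<epsilon> * ln (norm (grad \<phi> x)) / (4 * (real CARD('n) + p x))
         * ball_average x \<epsilon> (\<lambda>y. \<phi> (y + \<epsilon> *\<^sub>R grad p x) - \<phi> (y - \<epsilon> *\<^sub>R grad p x))"

definition le_zero_mod_o2 :: "(real \<Rightarrow> real) \<Rightarrow> bool" where
  "le_zero_mod_o2 E \<longleftrightarrow>
     (\<exists>r. ((\<lambda>\<epsilon>. r \<epsilon> / \<epsilon>\<^sup>2) \<longlongrightarrow> 0) (at_right 0) \<and> (\<forall>\<^sub>F \<epsilon> in at_right 0. E \<epsilon> + r \<epsilon> \<le> 0))"

definition ge_zero_mod_o2 :: "(real \<Rightarrow> real) \<Rightarrow> bool" where
  "ge_zero_mod_o2 E \<longleftrightarrow>
     (\<exists>r. ((\<lambda>\<epsilon>. r \<epsilon> / \<epsilon>\<^sup>2) \<longlongrightarrow> 0) (at_right 0) \<and> (\<forall>\<^sub>F \<epsilon> in at_right 0. E \<epsilon> + r \<epsilon> \<ge> 0))"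

definition viscosity_expansion_at ::
    "(real^'n) set \<Rightarrow> (real^'n \<Rightarrow> real) \<Rightarrow> (real^'n \<Rightarrow> real) \<Rightarrow> (real^'n \<Rightarrow> real)
      \<Rightarrow> (real^'n \<Rightarrow> real) \<Rightarrow> real^'n \<Rightarrow> bool" where
  "viscosity_expansion_at \<Omega> p \<alpha> \<beta> u x \<longleftrightarrow>
     (\<forall>\<phi>. C2_on \<Omega> \<phi> \<and> strict_min_at \<Omega> (\<lambda>y. u y - \<phi> y) x \<and> u x = \<phi> x \<and> grad \<phi> x \<noteq> 0
           \<longrightarrow> le_zero_mod_o2 (expansion_E p \<alpha> \<beta> \<phi> x)) \<and>
     (\<forall>\<phi>. C2_on \<Omega> \<phi> \<and> strict_max_at \<Omega> (\<lambda>y. u y - \<phi> y) x \<and> u x = \<phi> x \<and> grad \<phi> x \<noteq> 0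
           \<longrightarrow> ge_zero_mod_o2 (expansion_E p \<alpha> \<beta> \<phi> x))"

end

theory Submission
  imports Defs
begin

text \<open>
  Write \<open>n\<close> for the dimension. The asymptotic expansion is tested on smooth functions only, and for a
  \<open>C\<^sup>2\<close> function \<open>\<phi>\<close> with nonvanishing gradient at \<open>x\<close> all its terms can be computed to order \<open>\<epsilon>\<^sup>2\<close>:

  \<^item> the maximum and the minimum over the closed ball are, up to \<open>o(\<epsilon>\<^sup>2)\<close>, attained at
    \<open>x \<plusminus> \<epsilon> sgn (grad \<phi> x)\<close>, so half their sum exceeds \<open>\<phi> x\<close> by \<open>\<epsilon>\<^sup>2/2\<close> times the normalised infinity
    Laplacian (\<open>tendsto_Sup_cball\<close>, \<open>tendsto_Inf_cball\<close>);
  \<^item> the mean value over the ball exceeds \<open>\<phi> x\<close> by \<open>\<epsilon>\<^sup>2/(2(n + 2))\<close> times the Laplacian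
    (\<open>tendsto_ball_average_second_order\<close>), which rests on the second moments of the unit ball
    (\<open>ball_average_quadratic_form\<close>);
  \<^item> the averaged difference in the logarithmic term is \<open>2\<epsilon>\<close> times the inner product of the gradients of
    \<open>p\<close> and \<open>\<phi>\<close> (\<open>tendsto_ball_average_central_difference\<close>).

  The weights \<open>\<alpha>\<close> and \<open>\<beta>\<close> are chosen so that the sum is \<open>-\<epsilon>\<^sup>2/(2(n + p))\<close> times the operator
  \<open>neg_px_laplace\<close>, up to \<open>o(\<epsilon>\<^sup>2)\<close> (\<open>tendsto_expansion_E\<close>). Since \<open>n + p > 0\<close>, an inequality modulo
  \<open>o(\<epsilon>\<^sup>2)\<close> for the expansion at \<open>\<phi>\<close> is the same as the corresponding inequality for the operator at \<open>\<phi>\<close>.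
  The two notions then differ only in the normalisation \<open>u x = \<phi> x\<close>, which is achieved by adding a
  constant to \<open>\<phi>\<close>.

  All limits are taken after rescaling to the unit ball by \<open>y = x + \<epsilon> k\<close>: Taylor's formula is
  uniform convergence of difference quotients on a fixed ball, which averages and suprema respect.
\<close>

section \<open>Averages over balls\<close>

lemma ball_average_scaled:
  fixes f :: "real^'n \<Rightarrow> real"
  assumes "\<epsilon> > 0" "continuous_on (ball x \<epsilon>) f"
  shows "ball_average x \<epsilon> f = ball_average 0 1 (\<lambda>k. f (x + \<epsilon> *\<^sub>R k))"
proof -
  let ?g = "\<lambda>y. indicator (ball x \<epsilon>) y *\<^sub>R f y"
  have gm: "?g \<in> borel_measurable borel"
    by (rule borel_measurable_continuous_on_indicator) (use assms in auto)
  have ind: "indicator (ball x \<epsilon>) (x + \<epsilon> *\<^sub>R k) = (indicator (ball 0 1) k :: real)" for k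
    using assms(1) by (simp add: indicator_def dist_norm)
  have gm': "(\<lambda>k. indicator (ball 0 1) k *\<^sub>R f (x + \<epsilon> *\<^sub>R k)) \<in> borel_measurable borel"
    using measurable_compose[OF _ gm, of "\<lambda>k. x + \<epsilon> *\<^sub>R k" borel] by (simp add: ind)
  have "(LINT y:ball x \<epsilon>|lebesgue. f y) = integral\<^sup>L lborel ?g"
    unfolding set_lebesgue_integral_def using gm by (subst integral_completion) auto
  also have "\<dots> = integral\<^sup>L (density (distr lborel borel (\<lambda>k. x + \<epsilon> *\<^sub>R k)) (\<lambda>_. \<bar>\<epsilon>\<bar>^DIM(real^'n))) ?g"
    using lborel_affine[of \<epsilon> x] assms by simp
  also have "\<dots> = \<epsilon>^CARD('n) * (LINT k|lborel. ?g (x + \<epsilon> *\<^sub>R k))"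
    using gm assms by (subst integral_density; (subst integral_distr)?) (auto simp: ennreal_power[symmetric])
  also have "(LINT k|lborel. ?g (x + \<epsilon> *\<^sub>R k)) = (LINT k:ball 0 1|lebesgue. f (x + \<epsilon> *\<^sub>R k))"
    unfolding set_lebesgue_integral_def using gm' by (subst integral_completion) (auto simp: ind)
  finally have "(LINT y:ball x \<epsilon>|lebesgue. f y) = \<epsilon>^CARD('n) * (LINT k:ball 0 1|lebesgue. f (x + \<epsilon> *\<^sub>R k))" .
  moreover have "measure lebesgue (ball x \<epsilon>) = \<epsilon>^CARD('n) * measure lebesgue (ball (0::real^'n) 1)"
    using content_ball_conv_unit_ball[of \<epsilon> x] assms by simp
  ultimately show ?thesis
    using assms by (simp add: ball_average_def)
qed

lemma set_integrable_ball:
  fixes f :: "real^'n \<Rightarrow> real"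
  assumes "continuous_on (cball x r) f"
  shows "set_integrable lborel (ball x r) f" "set_integrable lebesgue (ball x r) f"
proof -
  have "set_integrable lborel (cball x r) f"
    unfolding set_integrable_def using assms by (intro borel_integrable_compact) auto
  then show 1: "set_integrable lborel (ball x r) f"
    by (rule set_integrable_subset) auto
  show "set_integrable lebesgue (ball x r) f"
    using 1 unfolding set_integrable_def
    by (subst integrable_completion) (auto intro: borel_measurable_integrable)
qed

lemma set_integral_ball_lebesgue_eq_lborel:
  fixes f :: "real^'n \<Rightarrow> real"
  assumes "continuous_on (cball x r) f"
  shows "(LINT y:ball x r|lebesgue. f y) = (LINT y:ball x r|lborel. f y)"
  using set_integrable_ball(1)[OF assms] unfolding set_integrable_def set_lebesgue_integral_def
  by (subst integral_completion) (auto intro: borel_measurable_integrable)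

lemma ball_average_add:
  fixes f g :: "real^'n \<Rightarrow> real"
  assumes "continuous_on (cball x r) f" "continuous_on (cball x r) g"
  shows "ball_average x r (\<lambda>y. f y + g y) = ball_average x r f + ball_average x r g"
  using assms by (simp add: ball_average_def set_integrable_ball add_divide_distrib)

lemma ball_average_cmult: "ball_average x r (\<lambda>y. c * f y) = c * ball_average x r f"
  by (simp add: ball_average_def)

lemma ball_average_sum:
  fixes f :: "'i \<Rightarrow> real^'n \<Rightarrow> real"
  assumes "finite I" "\<And>i. i \<in> I \<Longrightarrow> continuous_on (cball x r) (f i)"
  shows "ball_average x r (\<lambda>y. \<Sum>i\<in>I. f i y) = (\<Sum>i\<in>I. ball_average x r (f i))"
  using assms
proof (induction I rule: finite_induct)
  case empty
  show ?case by (simp add: ball_average_def set_lebesgue_integral_def)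
next
  case (insert i I)
  then show ?case
    by (simp add: ball_average_add continuous_on_sum)
qed

lemma measure_ball_pos: "r > 0 \<Longrightarrow> measure lebesgue (ball (x::real^'n) r) > 0"
  using content_ball_pos[of r x] by simp

lemma ball_average_const:
  "r > 0 \<Longrightarrow> ball_average x r (\<lambda>_. c) = c"
  using measure_ball_pos[of r x] emeasure_lborel_ball_finite[of x r]
  by (simp add: ball_average_def set_integral_const)

lemma ball_average_mono:
  fixes f g :: "real^'n \<Rightarrow> real"
  assumes "continuous_on (cball x r) f" "continuous_on (cball x r) g"
    and "\<And>y. y \<in> ball x r \<Longrightarrow> f y \<le> g y"
  shows "ball_average x r f \<le> ball_average x r g"
  unfolding ball_average_def
  by (intro divide_right_mono set_integral_mono set_integrable_ball assms) auto

text \<open>Taylor remainders converge uniformly on the closed unit ball, and this passes the limit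
  through the average.\<close>

lemma tendsto_ball_average:
  fixes F :: "'a \<Rightarrow> real^'n \<Rightarrow> real"
  assumes lim: "uniform_limit (cball x r) F P net"
    and F: "\<forall>\<^sub>F t in net. continuous_on (cball x r) (F t)"
    and P: "continuous_on (cball x r) P" and "r > 0"
  shows "((\<lambda>t. ball_average x r (F t)) \<longlongrightarrow> ball_average x r P) net"
proof (rule tendstoI)
  fix e :: real assume "e > 0"
  have "\<forall>\<^sub>F t in net. \<forall>y\<in>cball x r. dist (F t y) (P y) < e / 2"
    using uniform_limitD[OF lim, of "e/2"] \<open>e > 0\<close> by simp
  with F show "\<forall>\<^sub>F t in net. dist (ball_average x r (F t)) (ball_average x r P) < e"
  proof eventually_elim
    case (elim t)
    have bd: "\<bar>F t y - P y\<bar> < e / 2" if "y \<in> ball x r" for y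
      using elim that by (auto simp: dist_real_def)
    have "ball_average x r (F t) \<le> ball_average x r (\<lambda>y. P y + e / 2)"
      using bd by (intro ball_average_mono elim P continuous_intros) (smt (verit) field_sum_of_halves)
    moreover have "ball_average x r P \<le> ball_average x r (\<lambda>y. F t y + e / 2)"
      using bd by (intro ball_average_mono elim P continuous_intros) (smt (verit) field_sum_of_halves)
    ultimately show ?case
      using elim(1) P \<open>e > 0\<close>
      by (simp add: ball_average_add ball_average_const[OF \<open>r > 0\<close>] dist_real_def)
  qed
qed

section \<open>Moments of the unit ball\<close>

definition quarter_turn :: "'n::finite \<Rightarrow> 'n \<Rightarrow> real^'n \<Rightarrow> real^'n" where
  "quarter_turn i j h = (\<chi> k. if k = i then h $ j else if k = j then - h $ i else h $ k)"

lemma linear_quarter_turn: "linear (quarter_turn i j)"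
  unfolding quarter_turn_def by (rule linearI) (auto simp: vec_eq_iff algebra_simps)

lemma continuous_on_quarter_turn: "continuous_on S (quarter_turn i j)"
  using linear_quarter_turn by (intro linear_continuous_on) (simp add: linear_linear)

text \<open>Swapping coordinates \<open>i\<close> and \<open>j\<close> and changing one sign maps boxes to boxes and permutes
  their side lengths, and Lebesgue measure is determined by its values on boxes.\<close>

lemma lborel_distr_quarter_turn:
  fixes i j :: "'n::finite"
  assumes "i \<noteq> j"
  shows "distr lborel borel (quarter_turn i j) = lborel"
proof -
  let ?T = "quarter_turn i j"
  have meas: "?T \<in> borel_measurable borel"
    by (intro borel_measurable_continuous_onI continuous_on_quarter_turn)
  show ?thesis
  proof (rule lborel_eqI[symmetric])
    fix l u :: "real^'n"
    assume le: "\<And>b. b \<in> Basis \<Longrightarrow> l \<bullet> b \<le> u \<bullet> b"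
    have le': "l $ k \<le> u $ k" for k
      using le[of "axis k 1"] by (simp add: inner_axis axis_in_Basis_iff)
    define l' where "l' = (\<chi> k. if k = i then - u $ j else if k = j then l $ i else l $ k)"
    define u' where "u' = (\<chi> k. if k = i then - l $ j else if k = j then u $ i else u $ k)"
    have pre: "?T -` box l u = box l' u'"
    proof (rule set_eqI)
      fix h
      have "h \<in> ?T -` box l u \<longleftrightarrow> l $ i < ?T h $ i \<and> ?T h $ i < u $ i \<and> l $ j < ?T h $ j \<and> ?T h $ j < u $ j
          \<and> (\<forall>k. k \<noteq> i \<longrightarrow> k \<noteq> j \<longrightarrow> l $ k < ?T h $ k \<and> ?T h $ k < u $ k)"
        by (auto simp: mem_box_cart)
      also have "\<dots> \<longleftrightarrow> l' $ i < h $ i \<and> h $ i < u' $ i \<and> l' $ j < h $ j \<and> h $ j < u' $ j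
          \<and> (\<forall>k. k \<noteq> i \<longrightarrow> k \<noteq> j \<longrightarrow> l' $ k < h $ k \<and> h $ k < u' $ k)"
        using \<open>i \<noteq> j\<close> by (auto simp: quarter_turn_def l'_def u'_def)
      also have "\<dots> \<longleftrightarrow> h \<in> box l' u'"
        by (auto simp: mem_box_cart)
      finally show "h \<in> ?T -` box l u \<longleftrightarrow> h \<in> box l' u'" .
    qed
    have le2: "l' $ k \<le> u' $ k" for k
      using le' by (simp add: l'_def u'_def)
    have prod_cart: "(\<Prod>b\<in>Basis. (y - x) \<bullet> b) = (\<Prod>k\<in>UNIV. y $ k - x $ k)" for x y :: "real^'n"
      by (subst prod.reindex_bij_betw[of "\<lambda>k. axis k 1" UNIV Basis, symmetric])
         (auto simp: bij_betw_def inj_on_def axis_eq_axis Basis_vec_def inner_axis)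
    have "emeasure (distr lborel borel ?T) (box l u) = emeasure lborel (box l' u')"
      using meas by (subst emeasure_distr) (auto simp: pre)
    also have "\<dots> = (\<Prod>b\<in>Basis. (u' - l') \<bullet> b)"
      using le2 by (intro emeasure_lborel_box) (auto simp: Basis_vec_def inner_axis)
    also have "(\<Prod>b\<in>Basis. (u' - l') \<bullet> b) = (\<Prod>k\<in>UNIV. u $ Transposition.transpose i j k - l $ Transposition.transpose i j k)"
      unfolding prod_cart by (rule prod.cong) (auto simp: u'_def l'_def Transposition.transpose_def)
    also have "\<dots> = (\<Prod>k\<in>UNIV. u $ k - l $ k)"
      by (rule prod.reindex_bij_betw) simp
    also have "\<dots> = (\<Prod>b\<in>Basis. (u - l) \<bullet> b)"
      by (simp only: prod_cart)
    finally show "emeasure (distr lborel borel ?T) (box l u) = (\<Prod>b\<in>Basis. (u - l) \<bullet> b)" .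
  qed simp
qed

lemma norm_quarter_turn: "norm (quarter_turn i j h) = norm h"
proof -
  have "(\<Sum>k\<in>UNIV. (quarter_turn i j h $ k)\<^sup>2) = (\<Sum>k\<in>UNIV. (h $ Transposition.transpose i j k)\<^sup>2)"
    by (rule sum.cong) (auto simp: quarter_turn_def Transposition.transpose_def)
  also have "\<dots> = (\<Sum>k\<in>UNIV. (h $ k)\<^sup>2)"
    by (rule sum.reindex_bij_betw) simp
  finally show ?thesis
    by (simp add: norm_vec_def L2_set_def)
qed

lemma set_integral_ball_quarter_turn:
  fixes f :: "real^'n \<Rightarrow> real"
  assumes "i \<noteq> j" "continuous_on UNIV f"
  shows "(LINT h:ball 0 r|lborel. f (quarter_turn i j h)) = (LINT h:ball 0 r|lborel. f h)"
proof -
  let ?T = "quarter_turn i j"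
  have T: "?T \<in> borel_measurable borel"
    by (intro borel_measurable_continuous_onI continuous_on_quarter_turn)
  have "f \<in> borel_measurable borel"
    using assms by (simp add: borel_measurable_continuous_onI)
  then have fm: "(\<lambda>h. indicator (ball 0 r) h *\<^sub>R f h) \<in> borel_measurable borel"
    by (intro borel_measurable_scaleR borel_measurable_indicator) auto
  have ind: "indicator (ball 0 r) (?T h) = (indicator (ball 0 r) h :: real)" for h
    by (simp add: indicator_def norm_quarter_turn)
  have "(LINT h:ball 0 r|lborel. f h) = (LINT h:ball 0 r|distr lborel borel ?T. f h)"
    by (simp only: lborel_distr_quarter_turn[OF \<open>i \<noteq> j\<close>])
  also have "\<dots> = (LINT h:ball 0 r|lborel. f (?T h))"
    unfolding set_lebesgue_integral_def using T fm
    by (subst integral_distr) (simp_all add: ind)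
  finally show ?thesis ..
qed

lemma ball_average_quarter_turn:
  fixes f :: "real^'n \<Rightarrow> real"
  assumes "i \<noteq> j" "continuous_on UNIV f"
  shows "ball_average 0 r (\<lambda>h. f (quarter_turn i j h)) = ball_average 0 r f"
proof -
  have "continuous_on (cball 0 r) (\<lambda>h. f (quarter_turn i j h))"
    by (intro continuous_on_compose2[OF assms(2)] continuous_on_quarter_turn) auto
  moreover have "continuous_on (cball 0 r) f"
    using assms(2) continuous_on_subset by blast
  ultimately show ?thesis
    using set_integral_ball_quarter_turn[OF assms]
    by (simp add: ball_average_def set_integral_ball_lebesgue_eq_lborel)
qed

text \<open>A quarter turn in the plane of axes \<open>i\<close> and \<open>j\<close> shows that the averages of \<open>h $ i\<close> and
  \<open>h $ j\<close> are equal and also opposite. A second axis exists because the dimension is at least 2.\<close>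

lemma ball_average_coordinate:
  fixes i :: "'n::finite"
  assumes "CARD('n) \<ge> 2"
  shows "ball_average 0 r (\<lambda>h::real^'n. h $ i) = 0"
proof -
  have "\<not> (\<forall>j. j = i)"
  proof
    assume "\<forall>j. j = i"
    then have "(UNIV :: 'n set) = {i}" by auto
    then have "CARD('n) = card {i}" by (rule arg_cong)
    with assms show False by simp
  qed
  then obtain j where "i \<noteq> j" by metis
  have "ball_average 0 r (\<lambda>h::real^'n. h $ j) = ball_average 0 r (\<lambda>h::real^'n. h $ i)"
    using ball_average_quarter_turn[OF \<open>i \<noteq> j\<close>, of "\<lambda>h. h $ i" r]
    by (simp add: quarter_turn_def continuous_intros)
  moreover have "ball_average 0 r (\<lambda>h::real^'n. - h $ i) = ball_average 0 r (\<lambda>h::real^'n. h $ j)"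
    using ball_average_quarter_turn[OF \<open>i \<noteq> j\<close>, of "\<lambda>h. h $ j" r] \<open>i \<noteq> j\<close>
    by (simp add: quarter_turn_def continuous_intros)
  ultimately show ?thesis
    using ball_average_cmult[of 0 r "-1" "\<lambda>h. h $ i"] by simp
qed

lemma ball_average_linear:
  fixes g :: "real^'n"
  assumes "CARD('n) \<ge> 2"
  shows "ball_average 0 r (\<lambda>h. g \<bullet> h) = 0"
proof -
  have "ball_average 0 r (\<lambda>h. g \<bullet> h) = (\<Sum>i\<in>UNIV. g $ i * ball_average 0 r (\<lambda>h. h $ i))"
    unfolding inner_vec_def inner_real_def
    by (subst ball_average_sum) (auto simp: ball_average_cmult intro!: continuous_intros)
  then show ?thesis
    by (simp add: ball_average_coordinate[OF assms])
qed

text \<open>The quarter turn changes the sign of the integrand.\<close>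

lemma ball_average_mixed_product:
  fixes i j :: "'n::finite"
  assumes "i \<noteq> j"
  shows "ball_average 0 r (\<lambda>h::real^'n. h $ i * h $ j) = 0"
  using ball_average_quarter_turn[OF assms, of "\<lambda>h. h $ i * h $ j" r] assms
    ball_average_cmult[of 0 r "-1" "\<lambda>h. h $ i * h $ j"]
  by (simp add: quarter_turn_def continuous_intros mult.commute)

lemma ball_average_square_eq:
  fixes i j :: "'n::finite"
  shows "ball_average 0 r (\<lambda>h::real^'n. (h $ i)\<^sup>2) = ball_average 0 r (\<lambda>h::real^'n. (h $ j)\<^sup>2)"
  using ball_average_quarter_turn[of i j "\<lambda>h. (h $ i)\<^sup>2" r]
  by (cases "i = j") (simp_all add: quarter_turn_def continuous_intros)

lemma set_integral_norm_square_ball: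
  assumes "r > 0"
  shows "(LINT h:ball (0::real^'n) r|lebesgue. (norm h)\<^sup>2)
       = r ^ (CARD('n) + 2) * (LINT h:ball (0::real^'n) 1|lebesgue. (norm h)\<^sup>2)"
proof -
  let ?V = "\<lambda>r. measure lebesgue (ball (0::real^'n) r)"
  have "ball_average (0::real^'n) r (\<lambda>h. (norm h)\<^sup>2) = ball_average (0::real^'n) 1 (\<lambda>h. r\<^sup>2 * (norm h)\<^sup>2)"
    using ball_average_scaled[OF assms, of 0 "\<lambda>h. (norm h)\<^sup>2"] assms
    by (simp add: continuous_intros power_mult_distrib)
  also have "\<dots> = r\<^sup>2 * ball_average (0::real^'n) 1 (\<lambda>h. (norm h)\<^sup>2)"
    by (rule ball_average_cmult)
  finally have "(LINT h:ball (0::real^'n) r|lebesgue. (norm h)\<^sup>2) / ?V r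
      = r\<^sup>2 * ((LINT h:ball (0::real^'n) 1|lebesgue. (norm h)\<^sup>2) / ?V 1)"
    unfolding ball_average_def .
  moreover have "?V r = r ^ CARD('n) * ?V 1"
    using content_ball_conv_unit_ball[of r "0::real^'n"] assms by simp
  ultimately show ?thesis
    using measure_ball_pos[of 1 "0::real^'n"] assms
    by (simp add: field_simps power_add power2_eq_square)
qed

text \<open>Let \<open>V(r)\<close> be the volume of the ball of radius \<open>r\<close> and \<open>F(r)\<close> the integral of \<open>(norm h)\<^sup>2\<close>
  over it. They scale like \<open>r^n\<close> and \<open>r^(n + 2)\<close>. On the thin shell between radius 1 and
  radius \<open>r\<close> the integrand lies between 1 and \<open>r\<^sup>2\<close>, so \<open>F'(1) = V'(1)\<close>, that is,
  \<open>(n + 2) F(1) = n V(1)\<close>.\<close>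

lemma ball_average_norm_square:
  "ball_average (0::real^'n) 1 (\<lambda>h. (norm h)\<^sup>2) = real CARD('n) / (real CARD('n) + 2)"
proof -
  define a where "a = ball_average (0::real^'n) 1 (\<lambda>h. (norm h)\<^sup>2)"
  let ?n = "CARD('n)"
  let ?f = "\<lambda>h::real^'n. (norm h)\<^sup>2"
  let ?V = "\<lambda>r. measure lebesgue (ball (0::real^'n) r)"
  have V1: "?V 1 > 0" by (rule measure_ball_pos) simp
  have shell: "r ^ ?n - 1 \<le> a * (r ^ (?n + 2) - 1) \<and> a * (r ^ (?n + 2) - 1) \<le> r\<^sup>2 * (r ^ ?n - 1)"
    if "r > 1" for r
  proof -
    let ?S = "ball (0::real^'n) r - ball 0 1"
    have int: "set_integrable lebesgue (ball (0::real^'n) s) ?f" for s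
      by (rule set_integrable_ball) (intro continuous_intros)
    have intS: "set_integrable lebesgue ?S ?f"
      by (rule set_integrable_subset[OF int[of r]]) auto
    have un: "ball (0::real^'n) r = ?S \<union> ball 0 1"
      using \<open>r > 1\<close> by auto
    have F: "(LINT h:?S|lebesgue. ?f h) = (LINT h:ball 0 r|lebesgue. ?f h) - (LINT h:ball 0 1|lebesgue. ?f h)"
      by (subst un, subst set_integral_Un[OF _ intS int[of 1]]) auto
    also have "\<dots> = ?V 1 * (a * (r ^ (?n + 2) - 1))"
      using V1 set_integral_norm_square_ball[of r, where 'n='n] \<open>r > 1\<close>
      by (simp add: a_def ball_average_def field_simps)
    finally have F: "(LINT h:?S|lebesgue. ?f h) = ?V 1 * (a * (r ^ (?n + 2) - 1))" .
    have "measure lebesgue ?S = ?V r - ?V 1"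
      using \<open>r > 1\<close> by (intro measurable_measure_Diff) auto
    also have "\<dots> = ?V 1 * (r ^ ?n - 1)"
      using content_ball_conv_unit_ball[of r "0::real^'n"] \<open>r > 1\<close> by (simp add: algebra_simps)
    finally have S: "measure lebesgue ?S = ?V 1 * (r ^ ?n - 1)" .
    have fm: "?S \<in> lmeasurable" by (intro fmeasurable.Diff) auto
    have cint: "set_integrable lebesgue ?S (\<lambda>_. c)" for c :: real
      using fm by (simp add: set_integrable_def fmeasurable_def top.not_eq_extremum)
    have const: "(LINT h:?S|lebesgue. c) = ?V 1 * (r ^ ?n - 1) * c" for c :: real
      using fm S by (subst set_integral_const) (auto simp: fmeasurable_def)
    have "(LINT h:?S|lebesgue. 1) \<le> (LINT h:?S|lebesgue. ?f h)"
      using intS cint by (intro set_integral_mono) (auto intro: one_le_power)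
    moreover have "(LINT h:?S|lebesgue. ?f h) \<le> (LINT h:?S|lebesgue. r\<^sup>2)"
      using intS cint by (intro set_integral_mono) (auto intro!: power_mono)
    ultimately have "?V 1 * (r ^ ?n - 1) \<le> ?V 1 * (a * (r ^ (?n + 2) - 1))"
      "?V 1 * (a * (r ^ (?n + 2) - 1)) \<le> ?V 1 * (r\<^sup>2 * (r ^ ?n - 1))"
      unfolding F const by (auto simp: mult_ac)
    then show ?thesis using V1 by simp
  qed
  \<comment> \<open>exponent \<open>n\<close> gives \<open>V'(1)/V(1)\<close>, exponent \<open>n + 2\<close> gives \<open>F'(1)/F(1)\<close>\<close>
  have dpow: "((\<lambda>r::real. (r ^ m - 1) / (r - 1)) \<longlongrightarrow> real m) (at_right 1)" for m
  proof -
    have "((\<lambda>r::real. r ^ m) has_real_derivative real m) (at 1)"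
      by (auto intro!: derivative_eq_intros)
    then have "((\<lambda>r::real. (r ^ m - 1) / (r - 1)) \<longlongrightarrow> real m) (at 1)"
      by (simp add: has_field_derivative_iff)
    then show ?thesis
      by (rule filterlim_mono) (auto simp: at_le)
  qed
  have ev: "\<forall>\<^sub>F r::real in at_right 1. r > 1"
    by (simp add: eventually_at_right_less)
  have mid: "((\<lambda>r. a * ((r ^ (?n + 2) - 1) / (r - 1))) \<longlongrightarrow> a * real (?n + 2)) (at_right 1)"
    by (intro tendsto_intros dpow)
  have "real ?n \<le> a * real (?n + 2)"
  proof (rule tendsto_le[OF _ mid dpow])
    show "\<forall>\<^sub>F r in at_right 1. (r ^ ?n - 1) / (r - 1) \<le> a * ((r ^ (?n + 2) - 1) / (r - 1))"
      using ev by eventually_elim (use shell in \<open>auto simp: divide_right_mono\<close>)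
  qed simp
  moreover have "a * real (?n + 2) \<le> 1\<^sup>2 * real ?n"
  proof (rule tendsto_le[OF _ _ mid])
    show "((\<lambda>r. r\<^sup>2 * ((r ^ ?n - 1) / (r - 1))) \<longlongrightarrow> 1\<^sup>2 * real ?n) (at_right 1)"
      by (intro tendsto_intros dpow)
    show "\<forall>\<^sub>F r in at_right 1. a * ((r ^ (?n + 2) - 1) / (r - 1)) \<le> r\<^sup>2 * ((r ^ ?n - 1) / (r - 1))"
      using ev by eventually_elim (use shell in \<open>auto simp: divide_right_mono\<close>)
  qed simp
  ultimately show ?thesis
    by (simp add: a_def[symmetric] field_simps)
qed

lemma ball_average_coordinate_square:
  "ball_average 0 1 (\<lambda>h::real^'n. (h $ i)\<^sup>2) = 1 / (real CARD('n) + 2)"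
proof -
  have "ball_average (0::real^'n) 1 (\<lambda>h. (norm h)\<^sup>2) = (\<Sum>j\<in>UNIV. ball_average 0 1 (\<lambda>h::real^'n. (h $ j)\<^sup>2))"
    unfolding norm_vec_def L2_set_def
    by (subst ball_average_sum[symmetric]) (auto intro!: continuous_intros simp: sum_nonneg)
  also have "\<dots> = (\<Sum>j\<in>(UNIV::'n set). ball_average 0 1 (\<lambda>h::real^'n. (h $ i)\<^sup>2))"
    by (intro sum.cong ball_average_square_eq refl)
  finally show ?thesis
    unfolding ball_average_norm_square sum_constant by (simp add: divide_simps)
qed

text \<open>Mixed products average to 0, and by symmetry the squares share the average of
  \<open>(norm h)\<^sup>2\<close> equally; only the diagonal of \<open>A\<close> survives.\<close>

lemma ball_average_quadratic_form:
  fixes A :: "real^'n^'n"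
  shows "ball_average 0 1 (\<lambda>h. (A *v h) \<bullet> h) = trace A / (real CARD('n) + 2)"
proof -
  have eq: "(A *v h) \<bullet> h = (\<Sum>i\<in>UNIV. \<Sum>j\<in>UNIV. A $ i $ j * (h $ i * h $ j))" for h
    by (simp add: inner_vec_def matrix_vector_mult_def sum_distrib_right sum_distrib_left mult_ac)
  have "ball_average 0 1 (\<lambda>h. (A *v h) \<bullet> h)
      = (\<Sum>i\<in>UNIV. \<Sum>j\<in>UNIV. A $ i $ j * ball_average 0 1 (\<lambda>h. h $ i * h $ j))"
    unfolding eq
    by (subst ball_average_sum, (auto intro!: continuous_intros)[2])+
       (simp add: ball_average_sum ball_average_cmult continuous_intros)
  also have "\<dots> = (\<Sum>i\<in>UNIV. \<Sum>j\<in>UNIV. if i = j then A $ i $ i / (real CARD('n) + 2) else 0)"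
    using ball_average_coordinate_square[where 'n='n]
    by (intro sum.cong refl) (auto simp: ball_average_mixed_product power2_eq_square)
  also have "\<dots> = trace A / (real CARD('n) + 2)"
    by (simp add: trace_def sum_divide_distrib)
  finally show ?thesis .
qed

section \<open>Uniform Taylor expansions\<close>

lemma GDERIV_grad:
  assumes "f differentiable (at x)"
  shows "GDERIV f x :> grad f x"
proof -
  from assms obtain f' where f': "(f has_derivative f') (at x)"
    by (auto simp: differentiable_def)
  have "f' = (\<lambda>h. h \<bullet> adjoint f' 1)"
  proof
    fix h
    have "f' h = f' h \<bullet> 1" by simp
    also have "\<dots> = h \<bullet> adjoint f' 1"
      using has_derivative_linear[OF f'] by (simp add: adjoint_works)
    finally show "f' h = h \<bullet> adjoint f' 1" .
  qed
  then have "GDERIV f x :> adjoint f' 1"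
    using f' by (simp add: gderiv_def)
  then show ?thesis
    using grad_eq by metis
qed

lemma eventually_cball_subset:
  fixes x :: "real^'n"
  assumes "open S" "x \<in> S"
  shows "\<forall>\<^sub>F \<epsilon> in at_right 0. cball x (c * \<epsilon>) \<subseteq> S"
proof -
  obtain d where d: "d > 0" "cball x d \<subseteq> S"
    using open_contains_cball assms by blast
  have "((\<lambda>\<epsilon>. c * \<epsilon>) \<longlongrightarrow> c * 0) (at_right 0)"
    by (intro tendsto_intros)
  then have "\<forall>\<^sub>F \<epsilon> in at_right 0. c * \<epsilon> < d"
    using order_tendstoD(2)[of _ 0 "at_right 0" d] \<open>d > 0\<close> by simp
  then show ?thesis
    by eventually_elim (use d in force)
qed

lemma uniform_first_order_Taylor:
  fixes f :: "real^'n \<Rightarrow> real"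
  assumes "f differentiable (at x)"
  shows "uniform_limit (cball 0 R) (\<lambda>\<epsilon> k. (f (x + \<epsilon> *\<^sub>R k) - f x) / \<epsilon>) (\<lambda>k. grad f x \<bullet> k) (at_right 0)"
proof (rule uniform_limitI)
  fix e :: real assume "e > 0"
  define R' where "R' = \<bar>R\<bar> + 1"
  define e' where "e' = e / (2 * R')"
  have R': "R' > 0" "\<And>k::real^'n. k \<in> cball 0 R \<Longrightarrow> norm k \<le> R'"
    by (auto simp: R'_def)
  have e': "e' > 0" using \<open>e > 0\<close> R' by (simp add: e'_def)
  have "(f has_derivative (\<lambda>h. h \<bullet> grad f x)) (at x)"
    using GDERIV_grad[OF assms] by (simp add: gderiv_def)
  then obtain d where d: "d > 0"
    "\<And>y. norm (y - x) < d \<Longrightarrow> norm (f y - f x - (y - x) \<bullet> grad f x) \<le> e' * norm (y - x)"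
    using e' unfolding has_derivative_at_alt by meson
  have "\<forall>\<^sub>F \<epsilon> in at_right 0. \<epsilon> < d / R'"
    using d R' by (simp add: eventually_at_right_field) (meson divide_pos_pos)
  moreover have "\<forall>\<^sub>F \<epsilon>::real in at_right 0. \<epsilon> > 0"
    by (rule eventually_at_right_less)
  ultimately show "\<forall>\<^sub>F \<epsilon> in at_right 0. \<forall>k\<in>cball 0 R. dist ((f (x + \<epsilon> *\<^sub>R k) - f x) / \<epsilon>) (grad f x \<bullet> k) < e"
  proof eventually_elim
    case (elim \<epsilon>)
    show ?case
    proof
      fix k :: "real^'n" assume k: "k \<in> cball 0 R"
      have "\<epsilon> * norm k \<le> \<epsilon> * R'"
        using R'(2)[OF k] elim by simp
      also have "\<dots> < d" using elim R' by (simp add: field_simps)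
      finally have "\<bar>f (x + \<epsilon> *\<^sub>R k) - f x - \<epsilon> * (grad f x \<bullet> k)\<bar> \<le> e' * (\<epsilon> * norm k)"
        using d(2)[of "x + \<epsilon> *\<^sub>R k"] elim by (simp add: inner_commute)
      also have "\<dots> \<le> e' * (\<epsilon> * R')"
        using R'(2)[OF k] elim e' by simp
      also have "\<dots> = \<epsilon> * (e / 2)"
        using R' by (simp add: e'_def)
      finally have "\<bar>f (x + \<epsilon> *\<^sub>R k) - f x - \<epsilon> * (grad f x \<bullet> k)\<bar> / \<epsilon> \<le> e / 2"
        using elim by (simp add: field_simps)
      moreover have "\<bar>f (x + \<epsilon> *\<^sub>R k) - f x - \<epsilon> * (grad f x \<bullet> k)\<bar> / \<epsilon>
          = dist ((f (x + \<epsilon> *\<^sub>R k) - f x) / \<epsilon>) (grad f x \<bullet> k)"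
        using elim by (simp add: dist_real_def abs_div_pos diff_divide_distrib)
      ultimately show "dist ((f (x + \<epsilon> *\<^sub>R k) - f x) / \<epsilon>) (grad f x \<bullet> k) < e"
        using \<open>e > 0\<close> by simp
    qed
  qed
qed

text \<open>The mean value theorem along the segment from \<open>x\<close> to \<open>x + \<epsilon> k\<close>, applied to \<open>f\<close> minus its
  second-order polynomial, reduces the claim to differentiability of the gradient at \<open>x\<close>.\<close>

lemma uniform_second_order_Taylor:
  fixes f :: "real^'n \<Rightarrow> real"
  assumes "open S" "x \<in> S" "\<And>y. y \<in> S \<Longrightarrow> f differentiable (at y)" "grad f differentiable (at x)"
  shows "uniform_limit (cball 0 1)
           (\<lambda>\<epsilon> k. (f (x + \<epsilon> *\<^sub>R k) - f x - \<epsilon> * (grad f x \<bullet> k)) / \<epsilon>\<^sup>2)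
           (\<lambda>k. (hess f x *v k) \<bullet> k / 2) (at_right 0)"
proof (rule uniform_limitI)
  fix e :: real assume "e > 0"
  let ?g = "grad f x" and ?H = "hess f x"
  have "(grad f has_derivative (*v) ?H) (at x)"
    using assms(4) unfolding hess_def by (simp add: jacobian_works)
  then obtain d where d: "d > 0"
    "\<And>y. norm (y - x) < d \<Longrightarrow> norm (grad f y - ?g - ?H *v (y - x)) \<le> e / 2 * norm (y - x)"
    using \<open>e > 0\<close> unfolding has_derivative_at_alt by (meson half_gt_zero)
  obtain d' where d': "d' > 0" "ball x d' \<subseteq> S"
    using assms(1,2) open_contains_ball by blast
  have "\<forall>\<^sub>F \<epsilon> in at_right 0. \<epsilon> < min d d'"
    using d d' by (auto simp: eventually_at_right_field intro!: exI[of _ "min d d'"])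
  moreover have "\<forall>\<^sub>F \<epsilon>::real in at_right 0. \<epsilon> > 0"
    by (rule eventually_at_right_less)
  ultimately show "\<forall>\<^sub>F \<epsilon> in at_right 0. \<forall>k\<in>cball 0 1.
      dist ((f (x + \<epsilon> *\<^sub>R k) - f x - \<epsilon> * (?g \<bullet> k)) / \<epsilon>\<^sup>2) ((?H *v k) \<bullet> k / 2) < e"
  proof eventually_elim
    case (elim \<epsilon>)
    show ?case
    proof
      fix k :: "real^'n" assume "k \<in> cball 0 1"
      then have k: "norm k \<le> 1" by simp
      \<comment> \<open>\<open>f\<close> minus its second-order polynomial on the segment; \<open>\<psi>'\<close> is the derivative\<close>
      define \<psi> where "\<psi> t = f (x + t *\<^sub>R (\<epsilon> *\<^sub>R k)) - t * (\<epsilon> * (?g \<bullet> k)) - t\<^sup>2 * (\<epsilon>\<^sup>2 * ((?H *v k) \<bullet> k / 2))" for t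
      define \<psi>' where "\<psi>' t = \<epsilon> * ((grad f (x + t *\<^sub>R (\<epsilon> *\<^sub>R k)) - ?g - ?H *v (t *\<^sub>R (\<epsilon> *\<^sub>R k))) \<bullet> k)" for t
      have small: "norm (t *\<^sub>R (\<epsilon> *\<^sub>R k)) \<le> \<epsilon>" if "0 \<le> t" "t \<le> 1" for t
      proof -
        have "t * (\<epsilon> * norm k) \<le> 1 * (\<epsilon> * 1)"
          using that k elim by (intro mult_mono) auto
        then show ?thesis using that elim by simp
      qed
      have deriv: "(\<psi> has_real_derivative \<psi>' t) (at t)" if "0 \<le> t" "t \<le> 1" for t
      proof -
        have "x + t *\<^sub>R (\<epsilon> *\<^sub>R k) \<in> S"
          using small[OF that] elim d' by (auto simp: dist_norm subset_iff)
        then have "(f has_derivative (\<lambda>h. h \<bullet> grad f (x + t *\<^sub>R (\<epsilon> *\<^sub>R k)))) (at (x + t *\<^sub>R (\<epsilon> *\<^sub>R k)))"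
          using GDERIV_grad[OF assms(3)] by (simp add: gderiv_def)
        moreover have "((\<lambda>t. x + t *\<^sub>R (\<epsilon> *\<^sub>R k)) has_derivative (\<lambda>s. s *\<^sub>R (\<epsilon> *\<^sub>R k))) (at t)"
          by (auto intro!: derivative_eq_intros)
        ultimately have "((\<lambda>t. f (x + t *\<^sub>R (\<epsilon> *\<^sub>R k))) has_derivative
            (\<lambda>s. (s *\<^sub>R (\<epsilon> *\<^sub>R k)) \<bullet> grad f (x + t *\<^sub>R (\<epsilon> *\<^sub>R k)))) (at t)"
          by (rule has_derivative_compose[rotated])
        then have "((\<lambda>t. f (x + t *\<^sub>R (\<epsilon> *\<^sub>R k))) has_real_derivative
            \<epsilon> * (grad f (x + t *\<^sub>R (\<epsilon> *\<^sub>R k)) \<bullet> k)) (at t)"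
          by (rule has_derivative_imp_has_field_derivative) (simp add: inner_commute)
        then have "(\<psi> has_real_derivative \<epsilon> * (grad f (x + t *\<^sub>R (\<epsilon> *\<^sub>R k)) \<bullet> k) - \<epsilon> * (?g \<bullet> k)
            - 2 * t * (\<epsilon>\<^sup>2 * ((?H *v k) \<bullet> k / 2))) (at t)"
          unfolding \<psi>_def by (auto intro!: derivative_eq_intros)
        then show ?thesis
          by (rule DERIV_cong)
             (simp add: \<psi>'_def inner_diff_left matrix_vector_mult_scaleR power2_eq_square algebra_simps)
      qed
      have "\<exists>t. 0 < t \<and> t < 1 \<and> \<psi> 1 - \<psi> 0 = (1 - 0) * \<psi>' t"
        by (rule MVT2) (use deriv in auto)
      then obtain t where t: "0 < t" "t < 1" "\<psi> 1 - \<psi> 0 = \<psi>' t"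
        by auto
      have "norm (t *\<^sub>R (\<epsilon> *\<^sub>R k)) < d"
        using small[of t] t elim by linarith
      then have "norm (grad f (x + t *\<^sub>R (\<epsilon> *\<^sub>R k)) - ?g - ?H *v (t *\<^sub>R (\<epsilon> *\<^sub>R k)))
          \<le> e / 2 * norm (t *\<^sub>R (\<epsilon> *\<^sub>R k))"
        using d(2)[of "x + t *\<^sub>R (\<epsilon> *\<^sub>R k)"] by (simp only: add_diff_cancel_left')
      also have "\<dots> \<le> e / 2 * \<epsilon>"
        using small[of t] t \<open>e > 0\<close> by (intro mult_left_mono) auto
      finally have "norm (grad f (x + t *\<^sub>R (\<epsilon> *\<^sub>R k)) - ?g - ?H *v (t *\<^sub>R (\<epsilon> *\<^sub>R k))) * norm k \<le> e / 2 * \<epsilon> * 1"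
        using k elim \<open>e > 0\<close> by (intro mult_mono) auto
      then have "\<bar>(grad f (x + t *\<^sub>R (\<epsilon> *\<^sub>R k)) - ?g - ?H *v (t *\<^sub>R (\<epsilon> *\<^sub>R k))) \<bullet> k\<bar> \<le> e / 2 * \<epsilon>"
        using Cauchy_Schwarz_ineq2[of "grad f (x + t *\<^sub>R (\<epsilon> *\<^sub>R k)) - ?g - ?H *v (t *\<^sub>R (\<epsilon> *\<^sub>R k))" k] by linarith
      then have "\<bar>\<psi>' t\<bar> \<le> \<epsilon> * (e / 2 * \<epsilon>)"
        using elim by (simp add: \<psi>'_def abs_mult)
      then have "\<bar>\<psi> 1 - \<psi> 0\<bar> / \<epsilon>\<^sup>2 \<le> e / 2"
        using t elim by (simp add: power2_eq_square field_simps)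
      moreover have "\<bar>\<psi> 1 - \<psi> 0\<bar> / \<epsilon>\<^sup>2 =
          dist ((f (x + \<epsilon> *\<^sub>R k) - f x - \<epsilon> * (?g \<bullet> k)) / \<epsilon>\<^sup>2) ((?H *v k) \<bullet> k / 2)"
      proof -
        have "\<epsilon>\<^sup>2 * (a / \<epsilon>\<^sup>2 - b) = a - \<epsilon>\<^sup>2 * b" for a b
          using elim by (simp add: right_diff_distrib)
        then have "\<psi> 1 - \<psi> 0 = \<epsilon>\<^sup>2 * ((f (x + \<epsilon> *\<^sub>R k) - f x - \<epsilon> * (?g \<bullet> k)) / \<epsilon>\<^sup>2 - (?H *v k) \<bullet> k / 2)"
          by (simp add: \<psi>_def)
        then show ?thesis
          using elim by (simp add: dist_real_def abs_mult)
      qed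
      ultimately show "dist ((f (x + \<epsilon> *\<^sub>R k) - f x - \<epsilon> * (?g \<bullet> k)) / \<epsilon>\<^sup>2) ((?H *v k) \<bullet> k / 2) < e"
        using \<open>e > 0\<close> by simp
    qed
  qed
qed

section \<open>Extrema over small balls\<close>

lemma quadratic_form_lipschitz:
  fixes A :: "real^'n^'n"
  obtains K where "K \<ge> 0"
    "\<And>k l. norm k \<le> 1 \<Longrightarrow> norm l \<le> 1 \<Longrightarrow> (A *v k) \<bullet> k - (A *v l) \<bullet> l \<le> 2 * K * norm (k - l)"
proof -
  have "bounded_linear ((*v) A)" by simp
  then obtain K where K: "K \<ge> 0" "\<And>h. norm (A *v h) \<le> norm h * K"
    using bounded_linear.nonneg_bounded by blast
  show ?thesis
  proof
    fix k l :: "real^'n" assume kl: "norm k \<le> 1" "norm l \<le> 1"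
    have "(A *v k) \<bullet> k - (A *v l) \<bullet> l = (A *v (k - l)) \<bullet> k + (A *v l) \<bullet> (k - l)"
      by (simp add: matrix_vector_mult_diff_distrib inner_diff_left inner_diff_right)
    also have "\<dots> \<le> norm (A *v (k - l)) * norm k + norm (A *v l) * norm (k - l)"
      by (intro add_mono norm_cauchy_schwarz)
    also have "\<dots> \<le> (norm (k - l) * K) * 1 + (1 * K) * norm (k - l)"
      using K kl by (intro add_mono mult_mono order_trans[OF K(2)]) auto
    finally show "(A *v k) \<bullet> k - (A *v l) \<bullet> l \<le> 2 * K * norm (k - l)"
      by simp
  qed (rule K)
qed

text \<open>Over the unit ball the linear form \<open>g \<bullet> k\<close> peaks at \<open>k = sgn g\<close>, and at distance \<open>d\<close> from
  there it has lost at least \<open>norm g * d\<^sup>2 / 2\<close>. A perturbation that gains at most \<open>\<epsilon> K d\<close> can therefore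
  raise the maximum only by \<open>O(\<epsilon>\<^sup>2)\<close>; the constant comes from completing the square.\<close>

lemma perturbed_linear_form_le:
  fixes g k :: "real^'n"
  assumes "g \<noteq> 0" "norm k \<le> 1" "\<epsilon> \<ge> 0"
  shows "g \<bullet> k + \<epsilon> * K * norm (k - sgn g) \<le> norm g + \<epsilon>\<^sup>2 * K\<^sup>2 / (2 * norm g)"
proof -
  define d where "d = norm (k - sgn g)"
  have gs: "g = norm g *\<^sub>R sgn g"
    using assms by (simp add: sgn_div_norm)
  have "d\<^sup>2 = (norm k)\<^sup>2 - 2 * (sgn g \<bullet> k) + 1"
  proof -
    have "sgn g \<bullet> sgn g = 1"
      using assms by (simp add: dot_square_norm norm_sgn)
    then show ?thesis
      by (simp add: d_def power2_norm_eq_inner inner_diff_left inner_diff_right inner_commute)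
  qed
  also have "\<dots> \<le> 2 - 2 * (sgn g \<bullet> k)"
    using power_le_one[of "norm k" 2] assms by simp
  finally have "sgn g \<bullet> k \<le> 1 - d\<^sup>2 / 2" by simp
  then have "norm g * (sgn g \<bullet> k) \<le> norm g * (1 - d\<^sup>2 / 2)"
    by (intro mult_left_mono) auto
  then have "g \<bullet> k \<le> norm g * (1 - d\<^sup>2 / 2)"
    using gs by (metis inner_scaleR_left)
  moreover have "0 \<le> (norm g * d - \<epsilon> * K)\<^sup>2 / (2 * norm g)"
    by simp
  then have "\<epsilon> * K * d \<le> norm g * d\<^sup>2 / 2 + \<epsilon>\<^sup>2 * K\<^sup>2 / (2 * norm g)"
    using assms by (simp add: power2_eq_square field_simps)
  ultimately show ?thesis
    by (simp add: d_def[symmetric] algebra_simps)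
qed

text \<open>After the substitution \<open>y = x + \<epsilon> k\<close> the function is \<open>f x + \<epsilon> (g \<bullet> k) + \<epsilon>\<^sup>2 q(k)\<close> up to
  \<open>o(\<epsilon>\<^sup>2)\<close>, where \<open>q\<close> is half the quadratic form of \<open>A\<close>. The value at \<open>k = sgn g\<close> bounds the supremum
  from below. From above, moving \<open>k\<close> away from \<open>sgn g\<close> gains at most a Lipschitz multiple of
  \<open>\<epsilon>\<^sup>2 norm (k - sgn g)\<close>, which \<open>perturbed_linear_form_le\<close> makes negligible.\<close>

lemma tendsto_Sup_cball:
  fixes f :: "real^'n \<Rightarrow> real"
  assumes lim: "uniform_limit (cball 0 1) (\<lambda>\<epsilon> k. (f (x + \<epsilon> *\<^sub>R k) - f x - \<epsilon> * (g \<bullet> k)) / \<epsilon>\<^sup>2)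
      (\<lambda>k. (A *v k) \<bullet> k / 2) (at_right 0)"
    and "g \<noteq> 0"
  shows "((\<lambda>\<epsilon>. ((SUP y\<in>cball x \<epsilon>. f y) - f x - \<epsilon> * norm g) / \<epsilon>\<^sup>2)
           \<longlongrightarrow> (A *v g) \<bullet> g / (norm g)\<^sup>2 / 2) (at_right 0)"
proof (rule tendstoI)
  fix e :: real assume "e > 0"
  define q where "q k = (A *v k) \<bullet> k / 2" for k
  have q: "(A *v g) \<bullet> g / (norm g)\<^sup>2 / 2 = q (sgn g)"
    using \<open>g \<noteq> 0\<close> by (simp add: q_def sgn_div_norm matrix_vector_mult_scaleR power2_eq_square divide_simps)
  obtain K where K: "K \<ge> 0"
    "\<And>k l. norm k \<le> 1 \<Longrightarrow> norm l \<le> 1 \<Longrightarrow> (A *v k) \<bullet> k - (A *v l) \<bullet> l \<le> 2 * K * norm (k - l)"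
    using quadratic_form_lipschitz by blast
  have "((\<lambda>\<epsilon>. \<epsilon> * (K\<^sup>2 / (2 * norm g))) \<longlongrightarrow> 0 * (K\<^sup>2 / (2 * norm g))) (at_right 0)"
    by (intro tendsto_intros)
  then have "\<forall>\<^sub>F \<epsilon> in at_right 0. \<epsilon> * (K\<^sup>2 / (2 * norm g)) < e / 2"
    by (rule order_tendstoD) (use \<open>e > 0\<close> in simp)
  moreover have "\<forall>\<^sub>F \<epsilon>::real in at_right 0. \<epsilon> > 0"
    by (rule eventually_at_right_less)
  moreover have "\<forall>\<^sub>F \<epsilon> in at_right 0. \<forall>k\<in>cball 0 1.
      dist ((f (x + \<epsilon> *\<^sub>R k) - f x - \<epsilon> * (g \<bullet> k)) / \<epsilon>\<^sup>2) (q k) < e / 3"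
    using uniform_limitD[OF lim, of "e/3"] \<open>e > 0\<close> by (simp add: q_def)
  ultimately show "\<forall>\<^sub>F \<epsilon> in at_right 0.
      dist (((SUP y\<in>cball x \<epsilon>. f y) - f x - \<epsilon> * norm g) / \<epsilon>\<^sup>2) ((A *v g) \<bullet> g / (norm g)\<^sup>2 / 2) < e"
  proof eventually_elim
    case (elim \<epsilon>)
    have approx: "\<bar>f (x + \<epsilon> *\<^sub>R k) - f x - \<epsilon> * (g \<bullet> k) - \<epsilon>\<^sup>2 * q k\<bar> \<le> \<epsilon>\<^sup>2 * (e / 3)" if "norm k \<le> 1" for k
    proof -
      define D where "D = (f (x + \<epsilon> *\<^sub>R k) - f x - \<epsilon> * (g \<bullet> k)) / \<epsilon>\<^sup>2"
      have "\<bar>D - q k\<bar> \<le> e / 3"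
        using elim(3) that by (force simp: dist_real_def D_def)
      then have "\<bar>\<epsilon>\<^sup>2 * (D - q k)\<bar> \<le> \<epsilon>\<^sup>2 * (e / 3)"
        using elim(2) by (simp add: abs_mult)
      moreover have "f (x + \<epsilon> *\<^sub>R k) - f x - \<epsilon> * (g \<bullet> k) = \<epsilon>\<^sup>2 * D"
        using elim(2) by (simp add: D_def)
      ultimately show ?thesis
        by (simp add: right_diff_distrib)
    qed
    \<comment> \<open>5/6 = 1/3 + 1/2: the Taylor error and the gain away from \<open>sgn g\<close>\<close>
    let ?b = "f x + \<epsilon> * norm g + \<epsilon>\<^sup>2 * (q (sgn g) + 5 / 6 * e)"
    have upper: "f y \<le> ?b" if "y \<in> cball x \<epsilon>" for y
    proof -
      define k where "k = (y - x) /\<^sub>R \<epsilon>"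
      have y: "y = x + \<epsilon> *\<^sub>R k" using elim(2) by (simp add: k_def)
      have "norm k = dist x y / \<epsilon>"
        using elim(2) by (simp add: k_def dist_norm norm_minus_commute divide_inverse_commute)
      then have k: "norm k \<le> 1"
        using that elim(2) by simp
      have "q k \<le> q (sgn g) + K * norm (k - sgn g)"
        using K(2)[of k "sgn g"] k \<open>g \<noteq> 0\<close> by (simp add: q_def norm_sgn)
      then have "\<epsilon>\<^sup>2 * q k \<le> \<epsilon>\<^sup>2 * (q (sgn g) + K * norm (k - sgn g))"
        by (intro mult_left_mono) auto
      then have "\<epsilon> * (g \<bullet> k) + \<epsilon>\<^sup>2 * q k \<le> \<epsilon> * (g \<bullet> k + \<epsilon> * K * norm (k - sgn g)) + \<epsilon>\<^sup>2 * q (sgn g)"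
        by (simp add: algebra_simps power2_eq_square)
      also have "\<dots> \<le> \<epsilon> * (norm g + \<epsilon>\<^sup>2 * K\<^sup>2 / (2 * norm g)) + \<epsilon>\<^sup>2 * q (sgn g)"
        using perturbed_linear_form_le[OF \<open>g \<noteq> 0\<close> k, of \<epsilon> K] elim(2)
        by (intro add_right_mono mult_left_mono) auto
      also have "\<dots> = \<epsilon> * norm g + \<epsilon>\<^sup>2 * (q (sgn g) + \<epsilon> * (K\<^sup>2 / (2 * norm g)))"
        by (simp add: algebra_simps power2_eq_square)
      also have "\<dots> \<le> \<epsilon> * norm g + \<epsilon>\<^sup>2 * (q (sgn g) + e / 2)"
        using elim(1) by (intro add_left_mono mult_left_mono) auto
      finally have "\<epsilon> * (g \<bullet> k) + \<epsilon>\<^sup>2 * q k \<le> \<epsilon> * norm g + \<epsilon>\<^sup>2 * (q (sgn g) + e / 2)" .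
      moreover have "f y \<le> f x + \<epsilon> * (g \<bullet> k) + \<epsilon>\<^sup>2 * q k + \<epsilon>\<^sup>2 * (e / 3)"
        using abs_le_D1[OF approx[OF k]] unfolding y by linarith
      ultimately show ?thesis
        by (simp add: algebra_simps)
    qed
    have "(SUP y\<in>cball x \<epsilon>. f y) \<le> ?b"
      using upper elim(2) by (intro cSUP_least) auto
    then have 1: "(SUP y\<in>cball x \<epsilon>. f y) - f x - \<epsilon> * norm g - \<epsilon>\<^sup>2 * q (sgn g) \<le> \<epsilon>\<^sup>2 * (5 / 6 * e)"
      by (simp add: algebra_simps)
    have "f (x + \<epsilon> *\<^sub>R sgn g) \<le> (SUP y\<in>cball x \<epsilon>. f y)"
      using upper elim(2) \<open>g \<noteq> 0\<close> by (intro cSUP_upper bdd_aboveI2) (auto simp: dist_norm norm_sgn)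
    moreover have "g \<bullet> sgn g = norm g"
      using \<open>g \<noteq> 0\<close> by (simp add: sgn_div_norm dot_square_norm power2_eq_square)
    ultimately have 2: "- (\<epsilon>\<^sup>2 * (e / 3)) \<le> (SUP y\<in>cball x \<epsilon>. f y) - f x - \<epsilon> * norm g - \<epsilon>\<^sup>2 * q (sgn g)"
      using abs_le_D2[OF approx[of "sgn g"]] \<open>g \<noteq> 0\<close> by (simp add: norm_sgn)
    have "\<epsilon>\<^sup>2 * e > 0" using elim(2) \<open>e > 0\<close> by simp
    with 1 2 have "\<bar>(SUP y\<in>cball x \<epsilon>. f y) - f x - \<epsilon> * norm g - \<epsilon>\<^sup>2 * q (sgn g)\<bar> < \<epsilon>\<^sup>2 * e"
      by (simp add: abs_less_iff)
    moreover have "\<epsilon>\<^sup>2 * (a / \<epsilon>\<^sup>2 - b) = a - \<epsilon>\<^sup>2 * b" for a b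
      using elim(2) by (simp add: right_diff_distrib)
    then have "(SUP y\<in>cball x \<epsilon>. f y) - f x - \<epsilon> * norm g - \<epsilon>\<^sup>2 * q (sgn g)
      = \<epsilon>\<^sup>2 * (((SUP y\<in>cball x \<epsilon>. f y) - f x - \<epsilon> * norm g) / \<epsilon>\<^sup>2 - q (sgn g))"
      by simp
    ultimately show ?case
      using elim(2) unfolding q by (simp add: dist_real_def abs_mult)
  qed
qed

lemma tendsto_Inf_cball:
  fixes f :: "real^'n \<Rightarrow> real"
  assumes lim: "uniform_limit (cball 0 1) (\<lambda>\<epsilon> k. (f (x + \<epsilon> *\<^sub>R k) - f x - \<epsilon> * (g \<bullet> k)) / \<epsilon>\<^sup>2)
      (\<lambda>k. (A *v k) \<bullet> k / 2) (at_right 0)"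
    and "g \<noteq> 0"
  shows "((\<lambda>\<epsilon>. ((INF y\<in>cball x \<epsilon>. f y) - f x + \<epsilon> * norm g) / \<epsilon>\<^sup>2)
           \<longlongrightarrow> (A *v g) \<bullet> g / (norm g)\<^sup>2 / 2) (at_right 0)"
proof -
  have mv: "(- A) *v k = - (A *v k)" for k
    by (simp add: vec_eq_iff matrix_vector_mult_def sum_negf)
  have mv': "A *v (- k) = - (A *v k)" for k
    by (simp add: vec_eq_iff matrix_vector_mult_def sum_negf)
  have "uniform_limit (cball 0 1) (\<lambda>\<epsilon> k. - ((f (x + \<epsilon> *\<^sub>R k) - f x - \<epsilon> * (g \<bullet> k)) / \<epsilon>\<^sup>2))
      (\<lambda>k. - ((A *v k) \<bullet> k / 2)) (at_right 0)"
    by (rule uniform_limit_uminus[OF lim])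
  moreover have "- ((a - b - \<epsilon> * (g \<bullet> k)) / \<epsilon>\<^sup>2) = (- a - - b - \<epsilon> * (- g \<bullet> k)) / \<epsilon>\<^sup>2" for a b \<epsilon> k
    unfolding minus_divide_left by simp
  moreover have "- ((A *v k) \<bullet> k / 2) = (- A *v k) \<bullet> k / 2" for k
    by (simp add: mv)
  ultimately have "uniform_limit (cball 0 1) (\<lambda>\<epsilon> k. (- f (x + \<epsilon> *\<^sub>R k) - - f x - \<epsilon> * ((- g) \<bullet> k)) / \<epsilon>\<^sup>2)
      (\<lambda>k. ((- A) *v k) \<bullet> k / 2) (at_right 0)"
    by simp
  then have "((\<lambda>\<epsilon>. ((SUP y\<in>cball x \<epsilon>. - f y) - - f x - \<epsilon> * norm (- g)) / \<epsilon>\<^sup>2)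
           \<longlongrightarrow> ((- A) *v (- g)) \<bullet> (- g) / (norm (- g))\<^sup>2 / 2) (at_right 0)"
    by (rule tendsto_Sup_cball) (use \<open>g \<noteq> 0\<close> in simp)
  then have "((\<lambda>\<epsilon>. - (((SUP y\<in>cball x \<epsilon>. - f y) - - f x - \<epsilon> * norm (- g)) / \<epsilon>\<^sup>2))
           \<longlongrightarrow> - (((- A) *v (- g)) \<bullet> (- g) / (norm (- g))\<^sup>2 / 2)) (at_right 0)"
    by (rule tendsto_minus)
  moreover have "(INF y\<in>cball x \<epsilon>. f y) = - (SUP y\<in>cball x \<epsilon>. - f y)" for \<epsilon>
    by (simp add: Inf_real_def image_image)
  moreover have "- ((s - - b - \<epsilon> * norm (- g)) / \<epsilon>\<^sup>2) = (- s - b + \<epsilon> * norm g) / \<epsilon>\<^sup>2" for s b \<epsilon>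
    unfolding minus_divide_left by simp
  moreover have "- (((- A) *v (- g)) \<bullet> (- g) / (norm (- g))\<^sup>2 / 2) = (A *v g) \<bullet> g / (norm g)\<^sup>2 / 2"
    by (simp add: mv mv')
  ultimately show ?thesis
    by (simp only:)
qed

section \<open>Averages of smooth functions over small balls\<close>

text \<open>The linear part of the Taylor polynomial averages to 0 exactly, which is why dividing by
  \<open>\<epsilon>\<^sup>2\<close> is harmless although that part is of order \<open>\<epsilon>\<close>.\<close>

lemma tendsto_ball_average_second_order:
  fixes f :: "real^'n \<Rightarrow> real"
  assumes "CARD('n) \<ge> 2" "open S" "x \<in> S" "continuous_on S f"
    and lim: "uniform_limit (cball 0 1) (\<lambda>\<epsilon> k. (f (x + \<epsilon> *\<^sub>R k) - f x - \<epsilon> * (g \<bullet> k)) / \<epsilon>\<^sup>2)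
      (\<lambda>k. (A *v k) \<bullet> k / 2) (at_right 0)"
  shows "((\<lambda>\<epsilon>. (ball_average x \<epsilon> f - f x) / \<epsilon>\<^sup>2) \<longlongrightarrow> trace A / (2 * (real CARD('n) + 2))) (at_right 0)"
proof -
  define D where "D \<epsilon> k = (f (x + \<epsilon> *\<^sub>R k) - f x - \<epsilon> * (g \<bullet> k)) / \<epsilon>\<^sup>2" for \<epsilon> k
  have cont: "continuous_on (cball 0 1) (D \<epsilon>)" if "cball x \<epsilon> \<subseteq> S" "\<epsilon> > 0" for \<epsilon>
  proof -
    have "continuous_on (cball 0 1) (\<lambda>k. f (x + \<epsilon> *\<^sub>R k))"
      by (rule continuous_on_compose2[OF assms(4)])
         (use that in \<open>auto intro!: continuous_intros simp: subset_iff dist_norm\<close>)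
    then show ?thesis
      using that unfolding D_def by (intro continuous_intros) auto
  qed
  have small: "\<forall>\<^sub>F \<epsilon> in at_right 0. cball x \<epsilon> \<subseteq> S \<and> \<epsilon> > 0"
    using eventually_conj[OF eventually_cball_subset[OF assms(2,3), of 1] eventually_at_right_less] by simp
  have "((\<lambda>\<epsilon>. ball_average 0 1 (D \<epsilon>)) \<longlongrightarrow> ball_average 0 1 (\<lambda>k. (A *v k) \<bullet> k / 2)) (at_right 0)"
  proof (rule tendsto_ball_average)
    show "uniform_limit (cball 0 1) D (\<lambda>k. (A *v k) \<bullet> k / 2) (at_right 0)"
      using lim by (simp add: D_def[abs_def])
    show "\<forall>\<^sub>F \<epsilon> in at_right 0. continuous_on (cball 0 1) (D \<epsilon>)"
      using small by eventually_elim (use cont in auto)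
    show "continuous_on (cball 0 1) (\<lambda>k. (A *v k) \<bullet> k / 2)"
      by (intro continuous_intros linear_continuous_on) auto
  qed simp
  also have "ball_average 0 1 (\<lambda>k. (A *v k) \<bullet> k / 2) = trace A / (2 * (real CARD('n) + 2))"
    using ball_average_cmult[of "0::real^'n" 1 "1/2" "\<lambda>k. (A *v k) \<bullet> k"]
    by (simp add: ball_average_quadratic_form)
  finally have main: "((\<lambda>\<epsilon>. ball_average 0 1 (D \<epsilon>)) \<longlongrightarrow> trace A / (2 * (real CARD('n) + 2))) (at_right 0)" .
  have "\<forall>\<^sub>F \<epsilon> in at_right 0. ball_average 0 1 (D \<epsilon>) = (ball_average x \<epsilon> f - f x) / \<epsilon>\<^sup>2"
    using small
  proof eventually_elim
    case (elim \<epsilon>)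
    have "continuous_on (ball x \<epsilon>) f"
      using elim ball_subset_cball by (intro continuous_on_subset[OF assms(4)]) blast
    then have "ball_average x \<epsilon> f = ball_average 0 1 (\<lambda>k. f (x + \<epsilon> *\<^sub>R k))"
      using elim by (intro ball_average_scaled) auto
    also have "(\<lambda>k. f (x + \<epsilon> *\<^sub>R k)) = (\<lambda>k. f x + (\<epsilon> * (g \<bullet> k) + \<epsilon>\<^sup>2 * D \<epsilon> k))"
      using elim by (simp add: D_def)
    also have "ball_average 0 1 \<dots> = f x + (\<epsilon> * ball_average 0 1 (\<lambda>k. g \<bullet> k) + \<epsilon>\<^sup>2 * ball_average 0 1 (D \<epsilon>))"
      using cont[of \<epsilon>] elim
      by (simp add: ball_average_add ball_average_const ball_average_cmult continuous_intros)
    finally show ?case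
      using elim by (simp add: ball_average_linear[OF assms(1)])
  qed
  with main show ?thesis
    by (simp add: tendsto_cong)
qed

text \<open>First-order differentiability suffices: scaled to the unit ball, both shifted points lie within
  \<open>\<epsilon> (1 + norm v)\<close> of \<open>x\<close>, so the first-order expansion applies to both uniformly and the
  contributions of the averaging variable cancel.\<close>

lemma tendsto_ball_average_central_difference:
  fixes f :: "real^'n \<Rightarrow> real"
  assumes "open S" "x \<in> S" "continuous_on S f" "f differentiable (at x)"
  shows "((\<lambda>\<epsilon>. ball_average x \<epsilon> (\<lambda>y. f (y + \<epsilon> *\<^sub>R v) - f (y - \<epsilon> *\<^sub>R v)) / \<epsilon>) \<longlongrightarrow> 2 * (v \<bullet> grad f x)) (at_right 0)"
proof -
  define Q where "Q \<epsilon> k = (f (x + \<epsilon> *\<^sub>R k) - f x) / \<epsilon>" for \<epsilon> k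
  define R where "R = 1 + norm v"
  have shift: "k + v \<in> cball 0 R" "k - v \<in> cball 0 R" if "k \<in> cball 0 1" for k
    using that norm_triangle_ineq[of k v] norm_triangle_ineq4[of k v] by (auto simp: R_def)
  have Q: "uniform_limit (cball 0 R) Q (\<lambda>k. grad f x \<bullet> k) (at_right 0)"
    using uniform_first_order_Taylor[OF assms(4)] by (simp add: Q_def[abs_def])
  have lim: "uniform_limit (cball 0 1) (\<lambda>\<epsilon> k. Q \<epsilon> (k + v) - Q \<epsilon> (k - v))
      (\<lambda>k. grad f x \<bullet> (k + v) - grad f x \<bullet> (k - v)) (at_right 0)"
    using shift by (intro uniform_limit_minus uniform_limit_compose'[OF Q]) auto
  have inball: "x + \<epsilon> *\<^sub>R k \<in> cball x (R * \<epsilon>)" if "k \<in> cball 0 R" "\<epsilon> > 0" for \<epsilon> k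
    using that by (simp add: dist_norm mult.commute)
  have cont: "continuous_on (cball 0 1) (\<lambda>k. Q \<epsilon> (k + v) - Q \<epsilon> (k - v))"
    if "cball x (R * \<epsilon>) \<subseteq> S" "\<epsilon> > 0" for \<epsilon>
  proof -
    have "continuous_on (cball 0 R) (\<lambda>k. f (x + \<epsilon> *\<^sub>R k))"
      by (rule continuous_on_compose2[OF assms(3)])
         (use that inball in \<open>auto intro!: continuous_intros\<close>)
    then have Q_cont: "continuous_on (cball 0 R) (Q \<epsilon>)"
      using that unfolding Q_def by (intro continuous_intros) auto
    have "continuous_on (cball 0 1) (\<lambda>k. Q \<epsilon> (k + v))" "continuous_on (cball 0 1) (\<lambda>k. Q \<epsilon> (k - v))"
      by (rule continuous_on_compose2[OF Q_cont]; intro continuous_intros image_subsetI shift; assumption)+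
    then show ?thesis
      by (rule continuous_on_diff)
  qed
  have small: "\<forall>\<^sub>F \<epsilon> in at_right 0. cball x (R * \<epsilon>) \<subseteq> S \<and> \<epsilon> > 0"
    using eventually_conj[OF eventually_cball_subset[OF assms(1,2), of R] eventually_at_right_less] by simp
  have "((\<lambda>\<epsilon>. ball_average 0 1 (\<lambda>k. Q \<epsilon> (k + v) - Q \<epsilon> (k - v)))
      \<longlongrightarrow> ball_average 0 1 (\<lambda>k. grad f x \<bullet> (k + v) - grad f x \<bullet> (k - v))) (at_right 0)"
  proof (rule tendsto_ball_average[OF lim])
    show "\<forall>\<^sub>F \<epsilon> in at_right 0. continuous_on (cball 0 1) (\<lambda>k. Q \<epsilon> (k + v) - Q \<epsilon> (k - v))"
      using small by eventually_elim (use cont in auto)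
  qed (auto intro!: continuous_intros)
  also have "ball_average 0 1 (\<lambda>k. grad f x \<bullet> (k + v) - grad f x \<bullet> (k - v)) = 2 * (v \<bullet> grad f x)"
    by (simp add: inner_add_right inner_diff_right inner_commute ball_average_const)
  finally have main: "((\<lambda>\<epsilon>. ball_average 0 1 (\<lambda>k. Q \<epsilon> (k + v) - Q \<epsilon> (k - v)))
      \<longlongrightarrow> 2 * (v \<bullet> grad f x)) (at_right 0)" .
  have "\<forall>\<^sub>F \<epsilon> in at_right 0. ball_average 0 1 (\<lambda>k. Q \<epsilon> (k + v) - Q \<epsilon> (k - v))
      = ball_average x \<epsilon> (\<lambda>y. f (y + \<epsilon> *\<^sub>R v) - f (y - \<epsilon> *\<^sub>R v)) / \<epsilon>"
    using small
  proof eventually_elim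
    case (elim \<epsilon>)
    have sub: "y + \<epsilon> *\<^sub>R v \<in> S" "y - \<epsilon> *\<^sub>R v \<in> S" if "y \<in> ball x \<epsilon>" for y
    proof -
      define k where "k = (y - x) /\<^sub>R \<epsilon>"
      have "norm k = dist x y / \<epsilon>"
        using elim by (simp add: k_def dist_norm norm_minus_commute divide_inverse_commute)
      then have k: "y = x + \<epsilon> *\<^sub>R k" "k \<in> cball 0 1"
        using that elim by (auto simp: k_def)
      have "x + \<epsilon> *\<^sub>R (k + v) \<in> S" "x + \<epsilon> *\<^sub>R (k - v) \<in> S"
        using inball[OF shift(1)[OF k(2)], of \<epsilon>] inball[OF shift(2)[OF k(2)], of \<epsilon>] elim by auto
      then show "y + \<epsilon> *\<^sub>R v \<in> S" "y - \<epsilon> *\<^sub>R v \<in> S"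
        by (simp_all add: k algebra_simps)
    qed
    have "continuous_on (ball x \<epsilon>) (\<lambda>y. f (y + \<epsilon> *\<^sub>R v) - f (y - \<epsilon> *\<^sub>R v))"
      using sub by (intro continuous_intros continuous_on_compose2[OF assms(3)]) auto
    then have "ball_average x \<epsilon> (\<lambda>y. f (y + \<epsilon> *\<^sub>R v) - f (y - \<epsilon> *\<^sub>R v))
        = ball_average 0 1 (\<lambda>k. f (x + \<epsilon> *\<^sub>R k + \<epsilon> *\<^sub>R v) - f (x + \<epsilon> *\<^sub>R k - \<epsilon> *\<^sub>R v))"
      using elim by (intro ball_average_scaled) auto
    also have "(\<lambda>k. f (x + \<epsilon> *\<^sub>R k + \<epsilon> *\<^sub>R v) - f (x + \<epsilon> *\<^sub>R k - \<epsilon> *\<^sub>R v))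
        = (\<lambda>k. \<epsilon> * (Q \<epsilon> (k + v) - Q \<epsilon> (k - v)))"
    proof
      fix k
      have "Q \<epsilon> (k + v) - Q \<epsilon> (k - v) = (f (x + \<epsilon> *\<^sub>R (k + v)) - f (x + \<epsilon> *\<^sub>R (k - v))) / \<epsilon>"
        by (simp add: Q_def diff_divide_distrib)
      then show "f (x + \<epsilon> *\<^sub>R k + \<epsilon> *\<^sub>R v) - f (x + \<epsilon> *\<^sub>R k - \<epsilon> *\<^sub>R v) = \<epsilon> * (Q \<epsilon> (k + v) - Q \<epsilon> (k - v))"
        using elim by (simp add: scaleR_right_distrib scaleR_right_diff_distrib add.assoc add_diff_eq)
    qed
    finally show ?case
      using elim by (simp only: ball_average_cmult) simp
  qed
  with main show ?thesis
    by (simp add: tendsto_cong)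
qed

section \<open>The expansion of a smooth function and the operator\<close>

text \<open>With \<open>\<alpha> = (p - 2)/(n + p)\<close> and \<open>\<beta> = (n + 2)/(n + p)\<close> the four limits combine to the expanded
  operator. The terms \<open>\<plusminus>\<epsilon> norm (grad \<phi> x)\<close> of the maximum and minimum cancel, and \<open>\<alpha> + \<beta> = 1\<close> cancels
  the values \<open>\<phi> x\<close>. Because each term has a limit, and not just a
  one-sided bound, the argument also covers \<open>p < 2\<close>, where \<open>\<alpha>\<close> is negative.\<close>

lemma tendsto_expansion_E:
  fixes p \<alpha> \<beta> \<phi> :: "real^'n \<Rightarrow> real"
  assumes "CARD('n) \<ge> 2" "open \<Omega>" "x \<in> \<Omega>" and C2: "C2_on \<Omega> \<phi>" and g0: "grad \<phi> x \<noteq> 0"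
    and p: "p x > 1" and ab: "\<alpha> x + \<beta> x = 1" "\<beta> x \<noteq> 0" "\<alpha> x / \<beta> x = (p x - 2) / (real CARD('n) + 2)"
  shows "((\<lambda>\<epsilon>. expansion_E p \<alpha> \<beta> \<phi> x \<epsilon> / \<epsilon>\<^sup>2)
           \<longlongrightarrow> - neg_px_laplace p \<phi> x / (2 * (real CARD('n) + p x))) (at_right 0)"
proof -
  let ?n = "real CARD('n)" and ?g = "grad \<phi> x"
  define c where "c = ln (norm ?g) / (4 * (?n + p x))"
  have diff: "\<phi> differentiable (at y)" if "y \<in> \<Omega>" for y
    using C2 that by (simp add: C2_on_def C1_on_def)
  have cont: "continuous_on \<Omega> \<phi>"
    using diff by (auto intro!: continuous_at_imp_continuous_on differentiable_imp_continuous_within)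
  have "grad \<phi> differentiable (at x)"
    using C2 \<open>x \<in> \<Omega>\<close> by (simp add: C2_on_def)
  note Taylor = uniform_second_order_Taylor[OF \<open>open \<Omega>\<close> \<open>x \<in> \<Omega>\<close> diff this]
  have np: "?n + p x > 0" using p by linarith
  have "\<alpha> x * (?n + 2) = (p x - 2) * \<beta> x"
    using ab(2,3) by (simp add: field_simps)
  moreover have \<alpha>1: "\<alpha> x = 1 - \<beta> x" using ab(1) by simp
  ultimately have "\<beta> x * (?n + p x) = ?n + 2"
    by (simp add: algebra_simps)
  then have \<beta>: "\<beta> x = (?n + 2) / (?n + p x)"
    using np by (simp add: field_simps)
  have \<alpha>: "\<alpha> x = (p x - 2) / (?n + p x)"
    unfolding \<alpha>1 \<beta> using np by (simp add: field_simps)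
  define s where "s \<epsilon> = ((SUP y\<in>cball x \<epsilon>. \<phi> y) - \<phi> x - \<epsilon> * norm ?g) / \<epsilon>\<^sup>2" for \<epsilon>
  define i where "i \<epsilon> = ((INF y\<in>cball x \<epsilon>. \<phi> y) - \<phi> x + \<epsilon> * norm ?g) / \<epsilon>\<^sup>2" for \<epsilon>
  define m where "m \<epsilon> = (ball_average x \<epsilon> \<phi> - \<phi> x) / \<epsilon>\<^sup>2" for \<epsilon>
  define d where "d \<epsilon> = ball_average x \<epsilon> (\<lambda>y. \<phi> (y + \<epsilon> *\<^sub>R grad p x) - \<phi> (y - \<epsilon> *\<^sub>R grad p x)) / \<epsilon>" for \<epsilon>
  have s: "(s \<longlongrightarrow> inf_laplacian \<phi> x / 2) (at_right 0)"
    unfolding s_def[abs_def] inf_laplacian_def by (rule tendsto_Sup_cball[OF Taylor g0])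
  have i: "(i \<longlongrightarrow> inf_laplacian \<phi> x / 2) (at_right 0)"
    unfolding i_def[abs_def] inf_laplacian_def by (rule tendsto_Inf_cball[OF Taylor g0])
  have m: "(m \<longlongrightarrow> laplacian \<phi> x / (2 * (?n + 2))) (at_right 0)"
    unfolding m_def[abs_def] laplacian_def
    by (rule tendsto_ball_average_second_order[OF assms(1,2,3) cont Taylor])
  have d: "(d \<longlongrightarrow> 2 * (grad p x \<bullet> ?g)) (at_right 0)"
    unfolding d_def[abs_def]
    by (rule tendsto_ball_average_central_difference[OF \<open>open \<Omega>\<close> \<open>x \<in> \<Omega>\<close> cont diff[OF \<open>x \<in> \<Omega>\<close>]])
  have "((\<lambda>\<epsilon>. \<alpha> x / 2 * (s \<epsilon> + i \<epsilon>) + \<beta> x * m \<epsilon> + c * d \<epsilon>)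
      \<longlongrightarrow> \<alpha> x / 2 * (inf_laplacian \<phi> x / 2 + inf_laplacian \<phi> x / 2)
          + \<beta> x * (laplacian \<phi> x / (2 * (?n + 2))) + c * (2 * (grad p x \<bullet> ?g))) (at_right 0)"
    by (intro tendsto_intros s i m d)
  also have "\<alpha> x / 2 * (inf_laplacian \<phi> x / 2 + inf_laplacian \<phi> x / 2)
          + \<beta> x * (laplacian \<phi> x / (2 * (?n + 2))) + c * (2 * (grad p x \<bullet> ?g))
      = - neg_px_laplace p \<phi> x / (2 * (?n + p x))"
  proof -
    have "\<alpha> x / 2 * (L / 2 + L / 2) = (p x - 2) * L / (2 * (?n + p x))" for L
      by (simp add: \<alpha>)
    moreover have "\<beta> x * (L / (2 * (?n + 2))) = L / (2 * (?n + p x))" for L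
    proof -
      have "?n + 2 \<noteq> 0" by linarith
      then show ?thesis using np by (simp add: \<beta> divide_simps) (simp add: algebra_simps)
    qed
    moreover have "c * (2 * L) = ln (norm ?g) * L / (2 * (?n + p x))" for L
      using np by (simp add: c_def divide_simps)
    ultimately show ?thesis
      unfolding neg_px_laplace_def by (simp only: add_divide_distrib[symmetric]) (simp add: algebra_simps)
  qed
  finally have main: "((\<lambda>\<epsilon>. \<alpha> x / 2 * (s \<epsilon> + i \<epsilon>) + \<beta> x * m \<epsilon> + c * d \<epsilon>)
      \<longlongrightarrow> - neg_px_laplace p \<phi> x / (2 * (?n + p x))) (at_right 0)" .
  have "\<forall>\<^sub>F \<epsilon>::real in at_right 0. \<alpha> x / 2 * (s \<epsilon> + i \<epsilon>) + \<beta> x * m \<epsilon> + c * d \<epsilon>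
      = expansion_E p \<alpha> \<beta> \<phi> x \<epsilon> / \<epsilon>\<^sup>2"
    using eventually_at_right_less[of 0]
  proof eventually_elim
    case (elim \<epsilon>)
    have S: "(SUP y\<in>cball x \<epsilon>. \<phi> y) = \<phi> x + \<epsilon> * norm ?g + \<epsilon>\<^sup>2 * s \<epsilon>"
      and I: "(INF y\<in>cball x \<epsilon>. \<phi> y) = \<phi> x - \<epsilon> * norm ?g + \<epsilon>\<^sup>2 * i \<epsilon>"
      and M: "ball_average x \<epsilon> \<phi> = \<phi> x + \<epsilon>\<^sup>2 * m \<epsilon>"
      and D: "ball_average x \<epsilon> (\<lambda>y. \<phi> (y + \<epsilon> *\<^sub>R grad p x) - \<phi> (y - \<epsilon> *\<^sub>R grad p x)) = \<epsilon> * d \<epsilon>"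
      using elim by (simp_all add: s_def i_def m_def d_def)
    have "\<epsilon> * ln (norm ?g) / (4 * (?n + p x)) * (\<epsilon> * d \<epsilon>) = \<epsilon>\<^sup>2 * (c * d \<epsilon>)"
      by (simp add: c_def power2_eq_square)
    moreover have "- \<phi> x + \<alpha> x / 2 * ((\<phi> x + \<epsilon> * norm ?g + \<epsilon>\<^sup>2 * s \<epsilon>) + (\<phi> x - \<epsilon> * norm ?g + \<epsilon>\<^sup>2 * i \<epsilon>))
        + \<beta> x * (\<phi> x + \<epsilon>\<^sup>2 * m \<epsilon>) = \<epsilon>\<^sup>2 * (\<alpha> x / 2 * (s \<epsilon> + i \<epsilon>) + \<beta> x * m \<epsilon>)"
      unfolding \<alpha>1 by (simp add: field_simps)
    ultimately have "expansion_E p \<alpha> \<beta> \<phi> x \<epsilon> = \<epsilon>\<^sup>2 * (\<alpha> x / 2 * (s \<epsilon> + i \<epsilon>) + \<beta> x * m \<epsilon> + c * d \<epsilon>)"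
      unfolding expansion_E_def S I M D by (simp only: distrib_left)
    then show ?case
      using elim by simp
  qed
  with main show ?thesis
    by (simp add: tendsto_cong)
qed

text \<open>If \<open>E \<epsilon> / \<epsilon>\<^sup>2\<close> converges, a remainder \<open>o(\<epsilon>\<^sup>2)\<close> cannot affect the sign of the limit, and
  \<open>L \<epsilon>\<^sup>2 - E \<epsilon>\<close> is itself an admissible remainder.\<close>

lemma le_zero_mod_o2_iff:
  assumes "((\<lambda>\<epsilon>. E \<epsilon> / \<epsilon>\<^sup>2) \<longlongrightarrow> L) (at_right 0)"
  shows "le_zero_mod_o2 E \<longleftrightarrow> L \<le> 0"
proof
  assume "le_zero_mod_o2 E"
  then obtain r where r: "((\<lambda>\<epsilon>. r \<epsilon> / \<epsilon>\<^sup>2) \<longlongrightarrow> 0) (at_right 0)" "\<forall>\<^sub>F \<epsilon> in at_right 0. E \<epsilon> + r \<epsilon> \<le> 0"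
    unfolding le_zero_mod_o2_def by blast
  have "((\<lambda>\<epsilon>. E \<epsilon> / \<epsilon>\<^sup>2 + r \<epsilon> / \<epsilon>\<^sup>2) \<longlongrightarrow> L + 0) (at_right 0)"
    by (intro tendsto_add assms r)
  moreover have "\<forall>\<^sub>F \<epsilon> in at_right 0. E \<epsilon> / \<epsilon>\<^sup>2 + r \<epsilon> / \<epsilon>\<^sup>2 \<le> 0"
    using r(2) by eventually_elim (simp add: add_divide_distrib[symmetric] divide_nonpos_nonneg)
  ultimately show "L \<le> 0"
    using tendsto_upperbound[OF _ _ trivial_limit_at_right_real] by fastforce
next
  assume "L \<le> 0"
  have "((\<lambda>\<epsilon>. L - E \<epsilon> / \<epsilon>\<^sup>2) \<longlongrightarrow> L - L) (at_right 0)"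
    by (intro tendsto_intros assms)
  moreover have "\<forall>\<^sub>F \<epsilon>::real in at_right 0. L - E \<epsilon> / \<epsilon>\<^sup>2 = (L * \<epsilon>\<^sup>2 - E \<epsilon>) / \<epsilon>\<^sup>2"
    using eventually_at_right_less[of 0] by eventually_elim (simp add: diff_divide_distrib)
  ultimately have "((\<lambda>\<epsilon>. (L * \<epsilon>\<^sup>2 - E \<epsilon>) / \<epsilon>\<^sup>2) \<longlongrightarrow> 0) (at_right 0)"
    by (simp add: tendsto_cong)
  moreover have "\<forall>\<^sub>F \<epsilon> in at_right 0. E \<epsilon> + (L * \<epsilon>\<^sup>2 - E \<epsilon>) \<le> 0"
    using \<open>L \<le> 0\<close> by (simp add: mult_nonpos_nonneg)
  ultimately show "le_zero_mod_o2 E"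
    unfolding le_zero_mod_o2_def by (intro exI[of _ "\<lambda>\<epsilon>. L * \<epsilon>\<^sup>2 - E \<epsilon>"]) blast
qed

lemma ge_zero_mod_o2_iff_uminus: "ge_zero_mod_o2 E \<longleftrightarrow> le_zero_mod_o2 (\<lambda>\<epsilon>. - E \<epsilon>)"
proof
  assume "ge_zero_mod_o2 E"
  then obtain r where r: "((\<lambda>\<epsilon>. r \<epsilon> / \<epsilon>\<^sup>2) \<longlongrightarrow> 0) (at_right 0)" "\<forall>\<^sub>F \<epsilon> in at_right 0. E \<epsilon> + r \<epsilon> \<ge> 0"
    unfolding ge_zero_mod_o2_def by blast
  show "le_zero_mod_o2 (\<lambda>\<epsilon>. - E \<epsilon>)"
    unfolding le_zero_mod_o2_def using tendsto_minus[OF r(1)] r(2)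
    by (intro exI[of _ "\<lambda>\<epsilon>. - r \<epsilon>"]) (auto elim: eventually_mono)
next
  assume "le_zero_mod_o2 (\<lambda>\<epsilon>. - E \<epsilon>)"
  then obtain r where r: "((\<lambda>\<epsilon>. r \<epsilon> / \<epsilon>\<^sup>2) \<longlongrightarrow> 0) (at_right 0)" "\<forall>\<^sub>F \<epsilon> in at_right 0. - E \<epsilon> + r \<epsilon> \<le> 0"
    unfolding le_zero_mod_o2_def by blast
  show "ge_zero_mod_o2 E"
    unfolding ge_zero_mod_o2_def using tendsto_minus[OF r(1)] r(2)
    by (intro exI[of _ "\<lambda>\<epsilon>. - r \<epsilon>"]) (auto elim: eventually_mono)
qed

lemma viscosity_expansion_at_iff:
  fixes p u \<alpha> \<beta> :: "real^'n \<Rightarrow> real"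
  assumes "CARD('n) \<ge> 2" "open \<Omega>" "x \<in> \<Omega>" "p x > 1"
    and "\<alpha> x + \<beta> x = 1" "\<beta> x \<noteq> 0" "\<alpha> x / \<beta> x = (p x - 2) / (real CARD('n) + 2)"
  shows "viscosity_expansion_at \<Omega> p \<alpha> \<beta> u x \<longleftrightarrow>
     (\<forall>\<phi>. C2_on \<Omega> \<phi> \<and> strict_min_at \<Omega> (\<lambda>y. u y - \<phi> y) x \<and> u x = \<phi> x \<and> grad \<phi> x \<noteq> 0
           \<longrightarrow> neg_px_laplace p \<phi> x \<ge> 0) \<and>
     (\<forall>\<phi>. C2_on \<Omega> \<phi> \<and> strict_max_at \<Omega> (\<lambda>y. u y - \<phi> y) x \<and> u x = \<phi> x \<and> grad \<phi> x \<noteq> 0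
           \<longrightarrow> neg_px_laplace p \<phi> x \<le> 0)"
proof -
  have "real CARD('n) + p x > 0"
    using assms(4) by (intro add_nonneg_pos) simp_all
  then have c: "2 * (real CARD('n) + p x) > 0"
    by simp
  have "le_zero_mod_o2 (expansion_E p \<alpha> \<beta> \<phi> x) \<longleftrightarrow> neg_px_laplace p \<phi> x \<ge> 0"
    and "ge_zero_mod_o2 (expansion_E p \<alpha> \<beta> \<phi> x) \<longleftrightarrow> neg_px_laplace p \<phi> x \<le> 0"
    if \<phi>: "C2_on \<Omega> \<phi>" "grad \<phi> x \<noteq> 0" for \<phi>
  proof -
    note lim = tendsto_expansion_E[where p=p and \<alpha>=\<alpha> and \<beta>=\<beta>, OF assms(1-3) \<phi> assms(4-)]
    show "le_zero_mod_o2 (expansion_E p \<alpha> \<beta> \<phi> x) \<longleftrightarrow> neg_px_laplace p \<phi> x \<ge> 0"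
      using le_zero_mod_o2_iff[OF lim] c by (simp add: zero_le_divide_iff)
    have "((\<lambda>\<epsilon>. - expansion_E p \<alpha> \<beta> \<phi> x \<epsilon> / \<epsilon>\<^sup>2)
        \<longlongrightarrow> neg_px_laplace p \<phi> x / (2 * (real CARD('n) + p x))) (at_right 0)"
      using tendsto_minus[OF lim] by simp
    from le_zero_mod_o2_iff[OF this]
    show "ge_zero_mod_o2 (expansion_E p \<alpha> \<beta> \<phi> x) \<longleftrightarrow> neg_px_laplace p \<phi> x \<le> 0"
      using c by (simp add: ge_zero_mod_o2_iff_uminus divide_le_0_iff)
  qed
  then show ?thesis
    unfolding viscosity_expansion_at_def by blast
qed

section \<open>Normalising the test functions\<close>

lemma gderiv_add_const: "gderiv (\<lambda>y. f y + c) x = gderiv f x"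
proof (intro ext iffI)
  fix D
  show "GDERIV f x :> D" if "GDERIV (\<lambda>y. f y + c) x :> D"
    using GDERIV_diff[OF that GDERIV_const[of c]] by simp
  show "GDERIV (\<lambda>y. f y + c) x :> D" if "GDERIV f x :> D"
    using GDERIV_add[OF that GDERIV_const[of c]] by simp
qed

lemma grad_add_const: "grad (\<lambda>y. f y + c) = grad f"
  by (rule ext) (simp add: grad_def gderiv_add_const)

lemma neg_px_laplace_add_const: "neg_px_laplace p (\<lambda>y. f y + c) = neg_px_laplace p f"
  by (simp add: neg_px_laplace_def[abs_def] inf_laplacian_def laplacian_def hess_def grad_add_const)

lemma C2_on_add_const: "C2_on S f \<Longrightarrow> C2_on S (\<lambda>y. f y + c)"
  by (auto simp: C2_on_def C1_on_def hess_def[abs_def] grad_add_const intro!: differentiable_add)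

lemma strict_extremum_at_add_const:
  fixes u \<phi> :: "'a \<Rightarrow> real"
  shows "strict_min_at S (\<lambda>y. u y - (\<phi> y + c)) x = strict_min_at S (\<lambda>y. u y - \<phi> y) x"
    and "strict_max_at S (\<lambda>y. u y - (\<phi> y + c)) x = strict_max_at S (\<lambda>y. u y - \<phi> y) x"
  by (auto simp: strict_min_at_def strict_max_at_def algebra_simps)

theorem theorem3p5:
  fixes \<Omega> :: "(real^'n) set" and p u \<alpha> \<beta> :: "real^'n \<Rightarrow> real"
  assumes "CARD('n) \<ge> 2"
    and "open \<Omega>" and "connected \<Omega>" and "\<Omega> \<noteq> {}"
    and "\<And>x. x \<in> \<Omega> \<Longrightarrow> p x > 1" and "C1_on \<Omega> p"
    and "continuous_on \<Omega> u"
    and "\<And>x. x \<in> \<Omega> \<Longrightarrow> \<alpha> x + \<beta> x = 1"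
    and "\<And>x. x \<in> \<Omega> \<Longrightarrow> \<beta> x \<noteq> 0"
    and "\<And>x. x \<in> \<Omega> \<Longrightarrow> \<alpha> x / \<beta> x = (p x - 2) / (real CARD('n) + 2)"
  shows "viscosity_solution \<Omega> p u \<longleftrightarrow> (\<forall>x\<in>\<Omega>. viscosity_expansion_at \<Omega> p \<alpha> \<beta> u x)"
proof -
  have "viscosity_solution \<Omega> p u \<longleftrightarrow> (\<forall>x\<in>\<Omega>.
     (\<forall>\<phi>. C2_on \<Omega> \<phi> \<and> strict_min_at \<Omega> (\<lambda>y. u y - \<phi> y) x \<and> u x = \<phi> x \<and> grad \<phi> x \<noteq> 0
           \<longrightarrow> neg_px_laplace p \<phi> x \<ge> 0) \<and>
     (\<forall>\<phi>. C2_on \<Omega> \<phi> \<and> strict_max_at \<Omega> (\<lambda>y. u y - \<phi> y) x \<and> u x = \<phi> x \<and> grad \<phi> x \<noteq> 0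
           \<longrightarrow> neg_px_laplace p \<phi> x \<le> 0))" (is "_ \<longleftrightarrow> (\<forall>x\<in>\<Omega>. ?min x \<and> ?max x)")
  proof
    show "\<forall>x\<in>\<Omega>. ?min x \<and> ?max x" if "viscosity_solution \<Omega> p u"
      using that unfolding viscosity_solution_def by blast
    assume R: "\<forall>x\<in>\<Omega>. ?min x \<and> ?max x"
    show "viscosity_solution \<Omega> p u"
      unfolding viscosity_solution_def
    proof (intro ballI conjI allI impI)
      fix x \<phi> assume x: "x \<in> \<Omega>"
      \<comment> \<open>a vertical translate of \<open>\<phi>\<close> that touches \<open>u\<close> at \<open>x\<close>\<close>
      let ?\<phi> = "\<lambda>y. \<phi> y + (u x - \<phi> x)"
      show "neg_px_laplace p \<phi> x \<ge> 0"
        if "C2_on \<Omega> \<phi> \<and> strict_min_at \<Omega> (\<lambda>y. u y - \<phi> y) x \<and> grad \<phi> x \<noteq> 0"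
      proof -
        have "C2_on \<Omega> ?\<phi> \<and> strict_min_at \<Omega> (\<lambda>y. u y - ?\<phi> y) x \<and> u x = ?\<phi> x \<and> grad ?\<phi> x \<noteq> 0"
          using that by (simp add: C2_on_add_const strict_extremum_at_add_const grad_add_const)
        with R x have "neg_px_laplace p ?\<phi> x \<ge> 0" by blast
        then show ?thesis by (simp only: neg_px_laplace_add_const)
      qed
      show "neg_px_laplace p \<phi> x \<le> 0"
        if "C2_on \<Omega> \<phi> \<and> strict_max_at \<Omega> (\<lambda>y. u y - \<phi> y) x \<and> grad \<phi> x \<noteq> 0"
      proof -
        have "C2_on \<Omega> ?\<phi> \<and> strict_max_at \<Omega> (\<lambda>y. u y - ?\<phi> y) x \<and> u x = ?\<phi> x \<and> grad ?\<phi> x \<noteq> 0"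
          using that by (simp add: C2_on_add_const strict_extremum_at_add_const grad_add_const)
        with R x have "neg_px_laplace p ?\<phi> x \<le> 0" by blast
        then show ?thesis by (simp only: neg_px_laplace_add_const)
      qed
    qed
  qed
  also have "\<dots> \<longleftrightarrow> (\<forall>x\<in>\<Omega>. viscosity_expansion_at \<Omega> p \<alpha> \<beta> u x)"
    by (rule ball_cong[OF refl], rule viscosity_expansion_at_iff[symmetric])
       (use assms in auto)
  finally show ?thesis .
qed

end
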